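(* Let $R$ be a reduced ring and $M$ a faithful absolutely pure left $R$-module. Then one of the following holds. (1) $M$ has an infinite (properly) ascending chain of pp subgroups above any given proper pp subgroup. (2) $M$ is pp-simple, i.e., has no proper pp subgroups other than $0$. (3) The lattice of pp subgroups of $M$ contains a minimal nonzero element and a maximal proper element which are incomparable and whose sum is $M$.
   Context: Rings are associative with $1$, not necessarily commutative; a ring is reduced if it has no nonzero nilpotent elements. A module is absolutely pure if it is pure in every module containing it. A pp subgroup of $M$ is a subgroup of the form $\phi(M)=\{a\in M:\exists\bar c\ \text{in } M,\ A\bar c=\mathbf ba\}$ with $A$ an $n\times m$ matrix and $\mathbf b$ a column of length $n$ over $R$. The pp subgroups of $M$ form a lattice under intersection and sum. *)

theory Defs
  imports "HOL-Algebra.Algebra"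
begin

section \<open>Modules over rings that need not be commutative\<close>

text \<open>The locale \<open>module\<close> of \<open>HOL-Algebra\<close> requires a commutative ring; the axioms below are the
  same otherwise. The fields \<open>mult\<close> and \<open>one\<close> of the record of a module carry no information.\<close>

locale left_module = R?: ring R + M?: abelian_group M
  for R :: "('r, 'x) ring_scheme" (structure) and M :: "('r, 'm, 'y) module_scheme" (structure) +
  assumes smult_closed [simp, intro]:
      "\<lbrakk>a \<in> carrier R; x \<in> carrier M\<rbrakk> \<Longrightarrow> a \<odot>\<^bsub>M\<^esub> x \<in> carrier M"
    and smult_l_distr:
      "\<lbrakk>a \<in> carrier R; b \<in> carrier R; x \<in> carrier M\<rbrakk> \<Longrightarrow>
        (a \<oplus> b) \<odot>\<^bsub>M\<^esub> x = a \<odot>\<^bsub>M\<^esub> x \<oplus>\<^bsub>M\<^esub> b \<odot>\<^bsub>M\<^esub> x"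
    and smult_r_distr:
      "\<lbrakk>a \<in> carrier R; x \<in> carrier M; y \<in> carrier M\<rbrakk> \<Longrightarrow>
        a \<odot>\<^bsub>M\<^esub> (x \<oplus>\<^bsub>M\<^esub> y) = a \<odot>\<^bsub>M\<^esub> x \<oplus>\<^bsub>M\<^esub> a \<odot>\<^bsub>M\<^esub> y"
    and smult_assoc1:
      "\<lbrakk>a \<in> carrier R; b \<in> carrier R; x \<in> carrier M\<rbrakk> \<Longrightarrow>
        (a \<otimes> b) \<odot>\<^bsub>M\<^esub> x = a \<odot>\<^bsub>M\<^esub> (b \<odot>\<^bsub>M\<^esub> x)"
    and smult_one [simp]:
      "x \<in> carrier M \<Longrightarrow> \<one> \<odot>\<^bsub>M\<^esub> x = x"

locale reduced_ring = ring R for R (structure) +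
  assumes nilpotent_zero: "\<lbrakk>r \<in> carrier R; r [^] (k::nat) = \<zero>\<rbrakk> \<Longrightarrow> r = \<zero>"

definition faithful_module :: "('r, 'x) ring_scheme \<Rightarrow> ('r, 'm, 'y) module_scheme \<Rightarrow> bool" where
  "faithful_module R M \<longleftrightarrow>
    (\<forall>r\<in>carrier R. (\<forall>x\<in>carrier M. r \<odot>\<^bsub>M\<^esub> x = \<zero>\<^bsub>M\<^esub>) \<longrightarrow> r = \<zero>\<^bsub>R\<^esub>)"

definition left_module_hom ::
  "('r, 'x) ring_scheme \<Rightarrow> ('r, 'm, 'y) module_scheme \<Rightarrow> ('r, 'n, 'z) module_scheme \<Rightarrow> ('m \<Rightarrow> 'n) set" where
  "left_module_hom R M N = {f \<in> carrier M \<rightarrow> carrier N.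
    (\<forall>x\<in>carrier M. \<forall>y\<in>carrier M. f (x \<oplus>\<^bsub>M\<^esub> y) = f x \<oplus>\<^bsub>N\<^esub> f y) \<and>
    (\<forall>r\<in>carrier R. \<forall>x\<in>carrier M. f (r \<odot>\<^bsub>M\<^esub> x) = r \<odot>\<^bsub>N\<^esub> f x)}"


section \<open>Pp subgroups\<close>

text \<open>Matrices and columns are functions on indices; only the entries with indices below \<open>n\<close> and
  \<open>m\<close> matter.\<close>

definition pp_subgroup :: "('r, 'x) ring_scheme \<Rightarrow> ('r, 'm, 'y) module_scheme \<Rightarrow> 'm set \<Rightarrow> bool" where
  "pp_subgroup R M H \<longleftrightarrow> (\<exists>(n::nat) (m::nat) A b.
    A \<in> {..<n} \<rightarrow> {..<m} \<rightarrow> carrier R \<and> b \<in> {..<n} \<rightarrow> carrier R \<and>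
    H = {a \<in> carrier M. \<exists>c \<in> {..<m} \<rightarrow> carrier M.
          \<forall>i<n. (\<Oplus>\<^bsub>M\<^esub>j\<in>{..<m}. A i j \<odot>\<^bsub>M\<^esub> c j) = b i \<odot>\<^bsub>M\<^esub> a})"

definition pp_simple :: "('r, 'x) ring_scheme \<Rightarrow> ('r, 'm, 'y) module_scheme \<Rightarrow> bool" where
  "pp_simple R M \<longleftrightarrow> (\<forall>H. pp_subgroup R M H \<and> H \<noteq> carrier M \<longrightarrow> H = {\<zero>\<^bsub>M\<^esub>})"

definition minimal_pp_subgroup :: "('r, 'x) ring_scheme \<Rightarrow> ('r, 'm, 'y) module_scheme \<Rightarrow> 'm set \<Rightarrow> bool" where
  "minimal_pp_subgroup R M K \<longleftrightarrow> pp_subgroup R M K \<and> K \<noteq> {\<zero>\<^bsub>M\<^esub>} \<and>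
    (\<forall>H. pp_subgroup R M H \<and> H \<noteq> {\<zero>\<^bsub>M\<^esub>} \<and> H \<subseteq> K \<longrightarrow> H = K)"

definition maximal_pp_subgroup :: "('r, 'x) ring_scheme \<Rightarrow> ('r, 'm, 'y) module_scheme \<Rightarrow> 'm set \<Rightarrow> bool" where
  "maximal_pp_subgroup R M P \<longleftrightarrow> pp_subgroup R M P \<and> P \<noteq> carrier M \<and>
    (\<forall>H. pp_subgroup R M H \<and> H \<noteq> carrier M \<and> P \<subseteq> H \<longrightarrow> H = P)"


section \<open>Purity\<close>

text \<open>Pure: every finite system of linear equations with constants in \<open>H\<close> that is solvable in \<open>N\<close>
  is solvable in \<open>H\<close>.\<close>

definition pure_submodule :: "'n set \<Rightarrow> ('r, 'x) ring_scheme \<Rightarrow> ('r, 'n, 'z) module_scheme \<Rightarrow> bool" where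
  "pure_submodule H R N \<longleftrightarrow> submodule H R N \<and>
    (\<forall>(n::nat) (m::nat) A a. A \<in> {..<n} \<rightarrow> {..<m} \<rightarrow> carrier R \<and> a \<in> {..<n} \<rightarrow> H \<and>
      (\<exists>c \<in> {..<m} \<rightarrow> carrier N. \<forall>i<n. (\<Oplus>\<^bsub>N\<^esub>j\<in>{..<m}. A i j \<odot>\<^bsub>N\<^esub> c j) = a i) \<longrightarrow>
      (\<exists>c \<in> {..<m} \<rightarrow> H. \<forall>i<n. (\<Oplus>\<^bsub>N\<^esub>j\<in>{..<m}. A i j \<odot>\<^bsub>N\<^esub> c j) = a i))"

text \<open>A definition cannot quantify over the types of the extensions of \<open>M\<close>, so the extensions are
  taken with carrier in \<open>'m \<times> 'r list\<close>. This is no restriction: a failure of purity involves only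
  finitely many elements \<open>c\<^sub>0, \<dots>, c\<^sub>k\<close> of the extension, and the elements of \<open>M + R c\<^sub>0 + \<dots> + R c\<^sub>k\<close>
  can be represented in \<open>'m \<times> 'r list\<close>. The theorem \<open>absolutely_pureD\<close> below makes this precise:
  the property extends to extensions of arbitrary type.\<close>

definition absolutely_pure :: "('r, 'x) ring_scheme \<Rightarrow> ('r, 'm, 'y) module_scheme \<Rightarrow> bool" where
  "absolutely_pure R M \<longleftrightarrow> (\<forall>(N :: ('r, 'm \<times> 'r list) module) f.
    left_module R N \<and> f \<in> left_module_hom R M N \<and> inj_on f (carrier M) \<longrightarrow>
    pure_submodule (f ` carrier M) R N)"

lemma (in left_module) smult_l_null [simp]:
  assumes "x \<in> carrier M" shows "\<zero> \<odot>\<^bsub>M\<^esub> x = \<zero>\<^bsub>M\<^esub>"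
proof -
  have "\<zero> \<odot>\<^bsub>M\<^esub> x = \<zero> \<odot>\<^bsub>M\<^esub> x \<oplus>\<^bsub>M\<^esub> \<zero> \<odot>\<^bsub>M\<^esub> x"
    using smult_l_distr[of \<zero> \<zero> x] assms by simp
  then show ?thesis using assms by (metis M.add.r_cancel_one' smult_closed R.zero_closed)
qed

lemma (in left_module) smult_r_null [simp]:
  assumes "a \<in> carrier R" shows "a \<odot>\<^bsub>M\<^esub> \<zero>\<^bsub>M\<^esub> = \<zero>\<^bsub>M\<^esub>"
proof -
  have "a \<odot>\<^bsub>M\<^esub> \<zero>\<^bsub>M\<^esub> = a \<odot>\<^bsub>M\<^esub> \<zero>\<^bsub>M\<^esub> \<oplus>\<^bsub>M\<^esub> a \<odot>\<^bsub>M\<^esub> \<zero>\<^bsub>M\<^esub>"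
    using smult_r_distr[of a "\<zero>\<^bsub>M\<^esub>" "\<zero>\<^bsub>M\<^esub>"] assms by simp
  then show ?thesis using assms by (metis M.add.r_cancel_one' smult_closed M.zero_closed)
qed

lemma (in left_module) smult_minus_one:
  assumes "x \<in> carrier M" shows "(\<ominus> \<one>) \<odot>\<^bsub>M\<^esub> x = \<ominus>\<^bsub>M\<^esub> x"
proof -
  have "(\<ominus> \<one>) \<odot>\<^bsub>M\<^esub> x \<oplus>\<^bsub>M\<^esub> x = (\<ominus> \<one> \<oplus> \<one>) \<odot>\<^bsub>M\<^esub> x"
    using smult_l_distr[of "\<ominus> \<one>" \<one> x] assms by simp
  also have "\<dots> = \<zero>\<^bsub>M\<^esub>" using assms by (simp add: R.l_neg)
  finally show ?thesis using assms by (metis M.minus_equality R.a_inv_closed R.one_closed smult_closed)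
qed

lemma (in left_module) submodule_leftI:
  assumes "H \<subseteq> carrier M" "\<zero>\<^bsub>M\<^esub> \<in> H" "\<And>x y. \<lbrakk>x \<in> H; y \<in> H\<rbrakk> \<Longrightarrow> x \<oplus>\<^bsub>M\<^esub> y \<in> H"
    "\<And>r x. \<lbrakk>r \<in> carrier R; x \<in> H\<rbrakk> \<Longrightarrow> r \<odot>\<^bsub>M\<^esub> x \<in> H"
  shows "submodule H R M"
proof (intro submodule.intro subgroup.intro submodule_axioms.intro)
  fix x assume "x \<in> H"
  then have "\<ominus>\<^bsub>M\<^esub> x \<in> H"
    using assms(1) assms(4)[of "\<ominus> \<one>" x] smult_minus_one[of x] by auto
  then show "inv\<^bsub>add_monoid M\<^esub> x \<in> H" by (simp add: a_inv_def)
qed (use assms in auto)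

lemma left_module_hom_zero:
  assumes "left_module R M" "left_module R N" "f \<in> left_module_hom R M N"
  shows "f \<zero>\<^bsub>M\<^esub> = \<zero>\<^bsub>N\<^esub>"
proof -
  interpret M: left_module R M by fact
  interpret N: left_module R N by fact
  have f: "f \<zero>\<^bsub>M\<^esub> \<in> carrier N" using assms(3) by (auto simp: left_module_hom_def)
  have "f \<zero>\<^bsub>M\<^esub> = f (\<zero>\<^bsub>R\<^esub> \<odot>\<^bsub>M\<^esub> \<zero>\<^bsub>M\<^esub>)" by simp
  also have "\<dots> = \<zero>\<^bsub>R\<^esub> \<odot>\<^bsub>N\<^esub> f \<zero>\<^bsub>M\<^esub>"
    using assms(3) by (auto simp: left_module_hom_def simp del: M.smult_l_null M.smult_r_null)
  finally show ?thesis using f by simp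
qed

lemma left_module_hom_finsum:
  assumes "left_module R M" "left_module R N" "f \<in> left_module_hom R M N"
    "finite I" "h \<in> I \<rightarrow> carrier M"
  shows "f (\<Oplus>\<^bsub>M\<^esub>i\<in>I. h i) = (\<Oplus>\<^bsub>N\<^esub>i\<in>I. f (h i))"
proof -
  interpret M: left_module R M by fact
  interpret N: left_module R N by fact
  show ?thesis using assms(4,5)
  proof (induction I rule: finite_induct)
    case empty then show ?case using left_module_hom_zero[OF assms(1-3)] by simp
  next
    case (insert i I)
    have "(\<lambda>i. f (h i)) \<in> insert i I \<rightarrow> carrier N"
      using assms(3) insert.prems by (auto simp: left_module_hom_def)
    moreover have "finsum M h I \<in> carrier M" using insert by (intro M.finsum_closed) auto
    ultimately show ?case using insert assms(3) by (auto simp: left_module_hom_def Pi_iff)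
  qed
qed

lemma left_module_hom_image_submodule:
  assumes "left_module R M" "left_module R N" "f \<in> left_module_hom R M N"
  shows "submodule (f ` carrier M) R N"
proof -
  interpret M: left_module R M by fact
  interpret N: left_module R N by fact
  have f: "f \<in> carrier M \<rightarrow> carrier N"
    "\<And>x y. \<lbrakk>x \<in> carrier M; y \<in> carrier M\<rbrakk> \<Longrightarrow> f x \<oplus>\<^bsub>N\<^esub> f y = f (x \<oplus>\<^bsub>M\<^esub> y)"
    "\<And>r x. \<lbrakk>r \<in> carrier R; x \<in> carrier M\<rbrakk> \<Longrightarrow> r \<odot>\<^bsub>N\<^esub> f x = f (r \<odot>\<^bsub>M\<^esub> x)"
    using assms(3) by (auto simp: left_module_hom_def)
  show ?thesis
  proof (rule N.submodule_leftI)
    show "\<zero>\<^bsub>N\<^esub> \<in> f ` carrier M" using left_module_hom_zero[OF assms] by (metis M.zero_closed imageI)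
  qed (use f in auto)
qed

text \<open>Transport of a submodule of \<open>N\<close> to a set of codes \<open>C\<close> along a bijection \<open>v\<close>.\<close>

lemma left_module_transport:
  fixes N :: "('r, 'n, 'z) module_scheme" and v :: "'k \<Rightarrow> 'n"
  assumes N: "left_module R N" and sub: "submodule H R N" and v: "bij_betw v C H"
  defines "g \<equiv> inv_into C v"
  defines "K \<equiv> \<lparr>carrier = C, monoid.mult = (\<lambda>_ _. undefined), one = (undefined :: 'k), ring.zero = g \<zero>\<^bsub>N\<^esub>,
    ring.add = (\<lambda>p q. g (v p \<oplus>\<^bsub>N\<^esub> v q)), smult = (\<lambda>r p. g (r \<odot>\<^bsub>N\<^esub> v p))\<rparr>"
  shows "left_module R K" "v \<in> left_module_hom R K N"
proof -
  interpret N: left_module R N by fact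
  interpret subgroup H "add_monoid N" using sub by (rule submodule.axioms)
  have H: "H \<subseteq> carrier N" "\<zero>\<^bsub>N\<^esub> \<in> H" "\<And>x y. \<lbrakk>x \<in> H; y \<in> H\<rbrakk> \<Longrightarrow> x \<oplus>\<^bsub>N\<^esub> y \<in> H"
    "\<And>r x. \<lbrakk>r \<in> carrier R; x \<in> H\<rbrakk> \<Longrightarrow> r \<odot>\<^bsub>N\<^esub> x \<in> H"
    "\<And>x. x \<in> H \<Longrightarrow> \<ominus>\<^bsub>N\<^esub> x \<in> H"
    using subset one_closed m_closed submodule.smult_closed[OF sub] m_inv_closed by (auto simp: a_inv_def)
  have vH: "v p \<in> H" if "p \<in> C" for p using v that by (auto simp: bij_betw_def)
  then have vN: "v p \<in> carrier N" if "p \<in> C" for p using H(1) that by blast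
  have g: "g x \<in> C" "v (g x) = x" if "x \<in> H" for x
    using v that unfolding g_def by (auto simp: bij_betw_def inv_into_into f_inv_into_f)
  have gv: "g (v p) = p" if "p \<in> C" for p
    using v that unfolding g_def by (simp add: bij_betw_def)
  have "abelian_group K"
  proof (rule abelian_groupI)
    fix x assume "x \<in> carrier K"
    then have x: "x \<in> C" by (simp add: K_def)
    show "\<exists>y\<in>carrier K. y \<oplus>\<^bsub>K\<^esub> x = \<zero>\<^bsub>K\<^esub>"
      by (rule bexI[of _ "g (\<ominus>\<^bsub>N\<^esub> v x)"]) (use x H vH vN g in \<open>auto simp: K_def N.l_neg\<close>)
  qed (use H vH vN g gv in \<open>auto simp: K_def N.a_ac\<close>)
  moreover have "left_module_axioms R K"
    by unfold_locales
      (use H vH vN g gv in \<open>auto simp: K_def N.smult_l_distr N.smult_r_distr N.smult_assoc1\<close>)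
  ultimately show "left_module R K"
    using N.R.ring_axioms by (auto simp: left_module_def)
  show "v \<in> left_module_hom R K N"
    using H vH vN g by (auto simp: left_module_hom_def K_def)
qed

lemma submodule_adjoin:
  fixes c :: "nat \<Rightarrow> 'n"
  assumes M: "left_module R M" and N: "left_module R N" and f: "f \<in> left_module_hom R M N"
    and c: "c \<in> {..<m} \<rightarrow> carrier N"
  defines "D \<equiv> {(x, rs). x \<in> carrier M \<and> length rs = m \<and> set rs \<subseteq> carrier R}"
  defines "v \<equiv> \<lambda>(x, rs). f x \<oplus>\<^bsub>N\<^esub> (\<Oplus>\<^bsub>N\<^esub>j\<in>{..<m}. rs ! j \<odot>\<^bsub>N\<^esub> c j)"
  shows "submodule (v ` D) R N" "f ` carrier M \<subseteq> v ` D" "c \<in> {..<m} \<rightarrow> v ` D"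
proof -
  interpret M: left_module R M by fact
  interpret N: left_module R N by fact
  define S where "S r = (\<Oplus>\<^bsub>N\<^esub>j\<in>{..<m}. r j \<odot>\<^bsub>N\<^esub> c j)" for r
  have fN: "f x \<in> carrier N" if "x \<in> carrier M" for x
    using f that by (auto simp: left_module_hom_def)
  have cN: "c j \<in> carrier N" if "j < m" for j using c that by auto
  have SN: "S r \<in> carrier N" if "r \<in> {..<m} \<rightarrow> carrier R" for r
    unfolding S_def using that cN by (intro N.finsum_closed) auto
  have vD: "y \<in> v ` D \<longleftrightarrow> (\<exists>x\<in>carrier M. \<exists>r\<in>{..<m} \<rightarrow> carrier R. y = f x \<oplus>\<^bsub>N\<^esub> S r)" for y
  proof
    assume "y \<in> v ` D"
    then obtain x rs where *: "x \<in> carrier M" "length rs = m" "set rs \<subseteq> carrier R"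
      "y = f x \<oplus>\<^bsub>N\<^esub> S ((!) rs)"
      by (auto simp: D_def v_def S_def)
    then have "(!) rs \<in> {..<m} \<rightarrow> carrier R" by (auto simp: subset_iff)
    with * show "\<exists>x\<in>carrier M. \<exists>r\<in>{..<m} \<rightarrow> carrier R. y = f x \<oplus>\<^bsub>N\<^esub> S r" by blast
  next
    assume "\<exists>x\<in>carrier M. \<exists>r\<in>{..<m} \<rightarrow> carrier R. y = f x \<oplus>\<^bsub>N\<^esub> S r"
    then obtain x r where *: "x \<in> carrier M" "r \<in> {..<m} \<rightarrow> carrier R" "y = f x \<oplus>\<^bsub>N\<^esub> S r" by blast
    have "S ((!) (map r [0..<m])) = S r"
      unfolding S_def using * cN by (intro N.finsum_cong') auto
    then have "y = v (x, map r [0..<m])" using * by (simp add: v_def S_def)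
    moreover have "(x, map r [0..<m]) \<in> D" using * by (auto simp: D_def)
    ultimately show "y \<in> v ` D" by blast
  qed
  have S0: "S (\<lambda>_. \<zero>\<^bsub>R\<^esub>) = \<zero>\<^bsub>N\<^esub>"
  proof -
    have "S (\<lambda>_. \<zero>\<^bsub>R\<^esub>) = (\<Oplus>\<^bsub>N\<^esub>j\<in>{..<m}. \<zero>\<^bsub>N\<^esub>)"
      unfolding S_def using cN by (intro N.finsum_cong') auto
    then show ?thesis by (simp add: N.finsum_zero)
  qed
  have Sadd: "S (\<lambda>j. r j \<oplus>\<^bsub>R\<^esub> s j) = S r \<oplus>\<^bsub>N\<^esub> S s"
    if "r \<in> {..<m} \<rightarrow> carrier R" "s \<in> {..<m} \<rightarrow> carrier R" for r s
  proof -
    have "S (\<lambda>j. r j \<oplus>\<^bsub>R\<^esub> s j) = (\<Oplus>\<^bsub>N\<^esub>j\<in>{..<m}. r j \<odot>\<^bsub>N\<^esub> c j \<oplus>\<^bsub>N\<^esub> s j \<odot>\<^bsub>N\<^esub> c j)"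
      unfolding S_def using cN that by (intro N.finsum_cong') (auto simp: N.smult_l_distr Pi_iff)
    also have "\<dots> = S r \<oplus>\<^bsub>N\<^esub> S s"
      unfolding S_def using cN that by (intro N.finsum_addf) auto
    finally show ?thesis .
  qed
  have Ssm: "S (\<lambda>j. a \<otimes>\<^bsub>R\<^esub> r j) = a \<odot>\<^bsub>N\<^esub> S r"
    if "a \<in> carrier R" "r \<in> {..<m} \<rightarrow> carrier R" for a r
  proof -
    have hom: "(\<lambda>x. a \<odot>\<^bsub>N\<^esub> x) (\<Oplus>\<^bsub>N\<^esub>j\<in>I. h j) = (\<Oplus>\<^bsub>N\<^esub>j\<in>I. a \<odot>\<^bsub>N\<^esub> h j)"
      if "finite I" "h \<in> I \<rightarrow> carrier N" for I and h :: "nat \<Rightarrow> 'n"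
      using that
    proof (induction I rule: finite_induct)
      case empty then show ?case using \<open>a \<in> carrier R\<close> by simp
    next
      case (insert i I)
      then show ?case using \<open>a \<in> carrier R\<close> by (simp add: Pi_iff N.smult_r_distr)
    qed
    have "S (\<lambda>j. a \<otimes>\<^bsub>R\<^esub> r j) = (\<Oplus>\<^bsub>N\<^esub>j\<in>{..<m}. a \<odot>\<^bsub>N\<^esub> (r j \<odot>\<^bsub>N\<^esub> c j))"
      unfolding S_def using cN that by (intro N.finsum_cong') (auto simp: N.smult_assoc1 Pi_iff)
    also have "\<dots> = a \<odot>\<^bsub>N\<^esub> S r" unfolding S_def using cN that by (subst hom) auto
    finally show ?thesis .
  qed
  have fz: "f \<zero>\<^bsub>M\<^esub> = \<zero>\<^bsub>N\<^esub>" using left_module_hom_zero[OF M N f] .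
  have fM: "y \<in> v ` D" if "y \<in> f ` carrier M" for y
  proof -
    obtain x where "x \<in> carrier M" "y = f x" using \<open>y \<in> f ` carrier M\<close> by blast
    moreover have "f x = f x \<oplus>\<^bsub>N\<^esub> S (\<lambda>_. \<zero>\<^bsub>R\<^esub>)" using S0 \<open>x \<in> carrier M\<close> fN by simp
    ultimately show ?thesis unfolding vD by (intro bexI[of _ x] bexI[of _ "\<lambda>_. \<zero>\<^bsub>R\<^esub>"]) auto
  qed
  then show "f ` carrier M \<subseteq> v ` D" by blast
  show "submodule (v ` D) R N"
  proof (rule N.submodule_leftI)
    show "v ` D \<subseteq> carrier N" using fN SN vD by (metis N.a_closed subsetI)
    show "\<zero>\<^bsub>N\<^esub> \<in> v ` D" using fM fz M.zero_closed by (metis imageI)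
  next
    fix y z assume "y \<in> v ` D" "z \<in> v ` D"
    then obtain x r x' s where *: "x \<in> carrier M" "r \<in> {..<m} \<rightarrow> carrier R" "y = f x \<oplus>\<^bsub>N\<^esub> S r"
      "x' \<in> carrier M" "s \<in> {..<m} \<rightarrow> carrier R" "z = f x' \<oplus>\<^bsub>N\<^esub> S s"
      unfolding vD by blast
    have "y \<oplus>\<^bsub>N\<^esub> z = (f x \<oplus>\<^bsub>N\<^esub> f x') \<oplus>\<^bsub>N\<^esub> (S r \<oplus>\<^bsub>N\<^esub> S s)"
      using * fN[of x] fN[of x'] SN[of r] SN[of s] by (simp add: N.a_ac)
    also have "\<dots> = f (x \<oplus>\<^bsub>M\<^esub> x') \<oplus>\<^bsub>N\<^esub> S (\<lambda>j. r j \<oplus>\<^bsub>R\<^esub> s j)"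
      using f * by (simp add: Sadd left_module_hom_def)
    finally show "y \<oplus>\<^bsub>N\<^esub> z \<in> v ` D" unfolding vD
      using * by (intro bexI[of _ "x \<oplus>\<^bsub>M\<^esub> x'"] bexI[of _ "\<lambda>j. r j \<oplus>\<^bsub>R\<^esub> s j"]) auto
  next
    fix a y assume a: "a \<in> carrier R" and "y \<in> v ` D"
    then obtain x r where *: "x \<in> carrier M" "r \<in> {..<m} \<rightarrow> carrier R" "y = f x \<oplus>\<^bsub>N\<^esub> S r"
      unfolding vD by blast
    have "a \<odot>\<^bsub>N\<^esub> y = f (a \<odot>\<^bsub>M\<^esub> x) \<oplus>\<^bsub>N\<^esub> S (\<lambda>j. a \<otimes>\<^bsub>R\<^esub> r j)"
      using * a f fN[of x] SN[of r] by (simp add: Ssm N.smult_r_distr left_module_hom_def)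
    then show "a \<odot>\<^bsub>N\<^esub> y \<in> v ` D" unfolding vD
      using * a by (intro bexI[of _ "a \<odot>\<^bsub>M\<^esub> x"] bexI[of _ "\<lambda>j. a \<otimes>\<^bsub>R\<^esub> r j"]) auto
  qed
  show "c \<in> {..<m} \<rightarrow> v ` D"
  proof
    fix j assume j: "j \<in> {..<m}"
    let ?e = "\<lambda>i. if j = i then \<one>\<^bsub>R\<^esub> else \<zero>\<^bsub>R\<^esub>"
    have "S ?e = (\<Oplus>\<^bsub>N\<^esub>i\<in>{..<m}. if j = i then c i else \<zero>\<^bsub>N\<^esub>)"
      unfolding S_def using cN by (intro N.finsum_cong') auto
    also have "\<dots> = c j" using j cN by (intro N.finsum_singleton) auto
    finally have "c j = f \<zero>\<^bsub>M\<^esub> \<oplus>\<^bsub>N\<^esub> S ?e" using j cN fz by simp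
    then show "c j \<in> v ` D" unfolding vD by (intro bexI[of _ "\<zero>\<^bsub>M\<^esub>"] bexI[of _ ?e]) auto
  qed
qed

theorem absolutely_pureD:
  fixes R :: "('r, 'x) ring_scheme" and M :: "('r, 'm, 'y) module_scheme"
    and N :: "('r, 'n, 'z) module_scheme"
  assumes M: "left_module R M" and pure: "absolutely_pure R M"
    and N: "left_module R N" and f: "f \<in> left_module_hom R M N" and inj: "inj_on f (carrier M)"
  shows "pure_submodule (f ` carrier M) R N"
  unfolding pure_submodule_def
proof (intro conjI allI impI; (elim conjE bexE)?)
  show "submodule (f ` carrier M) R N" using M N f by (rule left_module_hom_image_submodule)
next
  fix n m :: nat and A a c
  assume A: "A \<in> {..<n} \<rightarrow> {..<m} \<rightarrow> carrier R" and a: "a \<in> {..<n} \<rightarrow> f ` carrier M"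
    and c: "c \<in> {..<m} \<rightarrow> carrier N"
    and sol: "\<forall>i<n. (\<Oplus>\<^bsub>N\<^esub>j\<in>{..<m}. A i j \<odot>\<^bsub>N\<^esub> c j) = a i"
  interpret M: left_module R M by fact
  interpret N: left_module R N by fact
  define D where "D = {(x, rs). x \<in> carrier M \<and> length rs = m \<and> set rs \<subseteq> carrier R}"
  define v where "v = (\<lambda>(x, rs). f x \<oplus>\<^bsub>N\<^esub> (\<Oplus>\<^bsub>N\<^esub>j\<in>{..<m}. rs ! j \<odot>\<^bsub>N\<^esub> c j))"
  define H where "H = v ` D"
  have H: "submodule H R N" "f ` carrier M \<subseteq> H" "c \<in> {..<m} \<rightarrow> H"
    using submodule_adjoin[OF M N f c] unfolding H_def v_def D_def by auto
  define C where "C = inv_into D v ` H"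
  have vC: "bij_betw v C H"
    unfolding C_def bij_betw_def
    by (auto simp: inj_on_def H_def f_inv_into_f image_image cong: image_cong)
  define g where "g = inv_into C v"
  define K :: "('r, 'm \<times> 'r list) module" where "K = \<lparr>carrier = C, monoid.mult = (\<lambda>_ _. undefined), one = undefined, ring.zero = g \<zero>\<^bsub>N\<^esub>,
    ring.add = (\<lambda>p q. g (v p \<oplus>\<^bsub>N\<^esub> v q)), smult = (\<lambda>r p. g (r \<odot>\<^bsub>N\<^esub> v p))\<rparr>"
  have K: "left_module R K" and vhom: "v \<in> left_module_hom R K N"
    using left_module_transport[OF N H(1) vC] unfolding K_def g_def by auto
  interpret K: left_module R K by fact
  have gC: "g x \<in> carrier K" "v (g x) = x" if "x \<in> H" for x
    using vC that unfolding g_def K_def by (auto simp: bij_betw_def inv_into_into f_inv_into_f)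
  have vinj: "inj_on v (carrier K)" using vC by (auto simp: K_def bij_betw_def)
  have fH: "f x \<in> H" if "x \<in> carrier M" for x using H(2) that by blast
  have aH: "a i \<in> H" if "i < n" for i
    by (rule subsetD[OF H(2)], rule Pi_mem[OF a]) (use that in simp)
  have vsys: "v (\<Oplus>\<^bsub>K\<^esub>j\<in>{..<m}. A i j \<odot>\<^bsub>K\<^esub> d j) = (\<Oplus>\<^bsub>N\<^esub>j\<in>{..<m}. A i j \<odot>\<^bsub>N\<^esub> v (d j))"
    "(\<Oplus>\<^bsub>K\<^esub>j\<in>{..<m}. A i j \<odot>\<^bsub>K\<^esub> d j) \<in> carrier K"
    if "i < n" "d \<in> {..<m} \<rightarrow> carrier K" for i d
  proof -
    have Ai: "A i j \<in> carrier R" if "j < m" for j using A \<open>i < n\<close> that by (auto simp: Pi_iff)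
    have dj: "d j \<in> carrier K" if "j < m" for j using \<open>d \<in> _\<close> that by auto
    have "v (\<Oplus>\<^bsub>K\<^esub>j\<in>{..<m}. A i j \<odot>\<^bsub>K\<^esub> d j) = (\<Oplus>\<^bsub>N\<^esub>j\<in>{..<m}. v (A i j \<odot>\<^bsub>K\<^esub> d j))"
      using Ai dj by (intro left_module_hom_finsum[OF K N vhom]) auto
    also have "\<dots> = (\<Oplus>\<^bsub>N\<^esub>j\<in>{..<m}. A i j \<odot>\<^bsub>N\<^esub> v (d j))"
      using Ai dj vhom by (intro N.finsum_cong') (auto simp: left_module_hom_def Pi_iff)
    finally show "v (\<Oplus>\<^bsub>K\<^esub>j\<in>{..<m}. A i j \<odot>\<^bsub>K\<^esub> d j) = (\<Oplus>\<^bsub>N\<^esub>j\<in>{..<m}. A i j \<odot>\<^bsub>N\<^esub> v (d j))" .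
    show "(\<Oplus>\<^bsub>K\<^esub>j\<in>{..<m}. A i j \<odot>\<^bsub>K\<^esub> d j) \<in> carrier K"
      using Ai dj by (intro K.finsum_closed) auto
  qed
  have hom: "(\<lambda>x. g (f x)) \<in> left_module_hom R M K"
    using f fH gC unfolding left_module_hom_def by (auto simp: K_def)
  have injg: "inj_on (\<lambda>x. g (f x)) (carrier M)"
    using inj fH gC(2) by (metis (no_types, lifting) inj_on_def)
  have P: "pure_submodule ((\<lambda>x. g (f x)) ` carrier M) R K"
    using pure K hom injg unfolding absolutely_pure_def by blast
  have "(\<lambda>i. g (a i)) \<in> {..<n} \<rightarrow> (\<lambda>x. g (f x)) ` carrier M"
    using a by (simp add: Pi_iff flip: image_image)
  moreover have "\<exists>d\<in>{..<m} \<rightarrow> carrier K. \<forall>i<n. (\<Oplus>\<^bsub>K\<^esub>j\<in>{..<m}. A i j \<odot>\<^bsub>K\<^esub> d j) = g (a i)"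
  proof (intro bexI[of _ "\<lambda>j. g (c j)"] allI impI)
    show d: "(\<lambda>j. g (c j)) \<in> {..<m} \<rightarrow> carrier K" using H(3) gC by auto
    fix i assume i: "i < n"
    have "v (\<Oplus>\<^bsub>K\<^esub>j\<in>{..<m}. A i j \<odot>\<^bsub>K\<^esub> g (c j)) = (\<Oplus>\<^bsub>N\<^esub>j\<in>{..<m}. A i j \<odot>\<^bsub>N\<^esub> v (g (c j)))"
      using vsys(1)[OF i d] .
    also have "\<dots> = (\<Oplus>\<^bsub>N\<^esub>j\<in>{..<m}. A i j \<odot>\<^bsub>N\<^esub> c j)"
      using A i c H(3) gC(2) by (intro N.finsum_cong') (auto simp: Pi_iff)
    also have "\<dots> = a i" using sol i by blast
    also have "\<dots> = v (g (a i))" using gC(2)[OF aH[OF i]] by simp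
    finally show "(\<Oplus>\<^bsub>K\<^esub>j\<in>{..<m}. A i j \<odot>\<^bsub>K\<^esub> g (c j)) = g (a i)"
      by (rule inj_onD[OF vinj _ vsys(2)[OF i d] gC(1)[OF aH[OF i]]])
  qed
  ultimately have "\<exists>d\<in>{..<m} \<rightarrow> (\<lambda>x. g (f x)) ` carrier M.
      \<forall>i<n. (\<Oplus>\<^bsub>K\<^esub>j\<in>{..<m}. A i j \<odot>\<^bsub>K\<^esub> d j) = g (a i)"
    using A by (intro P[unfolded pure_submodule_def, THEN conjunct2, THEN spec, THEN spec, THEN spec,
      THEN spec, THEN mp] conjI)
  then obtain d where d: "d \<in> {..<m} \<rightarrow> (\<lambda>x. g (f x)) ` carrier M"
    and dsol: "\<forall>i<n. (\<Oplus>\<^bsub>K\<^esub>j\<in>{..<m}. A i j \<odot>\<^bsub>K\<^esub> d j) = g (a i)"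
    by (rule bexE)
  show "\<exists>c\<in>{..<m} \<rightarrow> f ` carrier M. \<forall>i<n. (\<Oplus>\<^bsub>N\<^esub>j\<in>{..<m}. A i j \<odot>\<^bsub>N\<^esub> c j) = a i"
  proof (intro bexI[of _ "\<lambda>j. v (d j)"] allI impI)
    have dM: "\<exists>x\<in>carrier M. d j = g (f x)" if "j < m" for j
      using Pi_mem[OF d, of j] that by (simp add: image_iff)
    show "(\<lambda>j. v (d j)) \<in> {..<m} \<rightarrow> f ` carrier M"
    proof
      fix j assume "j \<in> {..<m}"
      then obtain x where "x \<in> carrier M" "d j = g (f x)" using dM by blast
      then show "v (d j) \<in> f ` carrier M" using gC(2)[OF fH] by simp
    qed
    fix i assume i: "i < n"
    have "d \<in> {..<m} \<rightarrow> carrier K"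
    proof
      fix j assume "j \<in> {..<m}"
      then obtain x where "x \<in> carrier M" "d j = g (f x)" using dM by blast
      then show "d j \<in> carrier K" using gC(1)[OF fH] by simp
    qed
    from vsys(1)[OF i this, symmetric]
    show "(\<Oplus>\<^bsub>N\<^esub>j\<in>{..<m}. A i j \<odot>\<^bsub>N\<^esub> v (d j)) = a i"
      using dsol i gC(2)[OF aH[OF i]] by simp
  qed
qed

end

theory Submission
  imports Defs
begin

text \<open>Failure of (1) gives a maximal proper pp subgroup \<open>P\<close>. In an absolutely pure module every
  consistent finite system of linear equations is solvable, so \<open>P\<close> is annihilated by some \<open>r \<noteq> 0\<close>.
  As \<open>r\<^sup>2 \<noteq> 0\<close>, faithfulness makes the annihilators of \<open>r\<close> and of \<open>r\<^sup>2\<close> proper; they contain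
  \<open>P\<close>, hence both are \<open>P\<close>, and therefore \<open>r M \<inter> P = 0\<close>. A nonzero pp subgroup \<open>L \<subseteq> r M\<close> is
  not contained in \<open>P\<close>, so \<open>L + P = M\<close>, and \<open>L = r M\<close> by the modular law. Thus \<open>K = r M\<close> is
  minimal and complements \<open>P\<close>, while \<open>P = 0\<close> means that \<open>M\<close> is pp-simple.\<close>

section \<open>Quotients and linear combinations\<close>

context left_module
begin

lemma smult_minus:
  assumes "a \<in> carrier R" "x \<in> carrier M"
  shows "a \<odot>\<^bsub>M\<^esub> (\<ominus>\<^bsub>M\<^esub> x) = \<ominus>\<^bsub>M\<^esub> (a \<odot>\<^bsub>M\<^esub> x)"
proof -
  have "a \<odot>\<^bsub>M\<^esub> (\<ominus>\<^bsub>M\<^esub> x) \<oplus>\<^bsub>M\<^esub> a \<odot>\<^bsub>M\<^esub> x = \<zero>\<^bsub>M\<^esub>"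
    using assms smult_r_distr[of a "\<ominus>\<^bsub>M\<^esub> x" x] by (simp add: M.l_neg)
  then show ?thesis using assms by (metis M.minus_equality smult_closed M.a_inv_closed)
qed

lemma finsum_smult:
  assumes "finite I" "a \<in> carrier R" "h \<in> I \<rightarrow> carrier M"
  shows "a \<odot>\<^bsub>M\<^esub> (\<Oplus>\<^bsub>M\<^esub>i\<in>I. h i) = (\<Oplus>\<^bsub>M\<^esub>i\<in>I. a \<odot>\<^bsub>M\<^esub> h i)"
  using assms
proof (induction I rule: finite_induct)
  case (insert i I)
  have "(\<lambda>i. a \<odot>\<^bsub>M\<^esub> h i) \<in> I \<rightarrow> carrier M" using insert.prems by auto
  then show ?case using insert by (simp add: Pi_iff smult_r_distr)
qed simp

lemma finsum_scalars_smult: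
  assumes "finite I" "x \<in> carrier M" "y \<in> I \<rightarrow> carrier R"
  shows "(\<Oplus>i\<in>I. y i) \<odot>\<^bsub>M\<^esub> x = (\<Oplus>\<^bsub>M\<^esub>i\<in>I. y i \<odot>\<^bsub>M\<^esub> x)"
  using assms
proof (induction I rule: finite_induct)
  case (insert i I)
  have "(\<lambda>i. y i \<odot>\<^bsub>M\<^esub> x) \<in> I \<rightarrow> carrier M" using insert.prems by auto
  moreover have "finsum R y I \<in> carrier R" using insert.prems by (intro R.finsum_closed) auto
  ultimately show ?case using insert by (simp add: Pi_iff smult_l_distr)
qed simp

text \<open>Lets a double sum over the rows and columns of a matrix be regrouped, so that a relation
  among the rows can be applied to a solution column by column.\<close>

lemma finsum_swap:
  assumes "finite I" "finite J" "\<And>i j. \<lbrakk>i \<in> I; j \<in> J\<rbrakk> \<Longrightarrow> h i j \<in> carrier M"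
  shows "(\<Oplus>\<^bsub>M\<^esub>i\<in>I. \<Oplus>\<^bsub>M\<^esub>j\<in>J. h i j) = (\<Oplus>\<^bsub>M\<^esub>j\<in>J. \<Oplus>\<^bsub>M\<^esub>i\<in>I. h i j)"
  using assms(1,3)
proof (induction I rule: finite_induct)
  case empty
  then show ?case by (simp add: M.finsum_zero)
next
  case (insert i I)
  have cl: "(\<lambda>k. \<Oplus>\<^bsub>M\<^esub>j\<in>J. h k j) \<in> insert i I \<rightarrow> carrier M"
    "(\<lambda>j. \<Oplus>\<^bsub>M\<^esub>k\<in>I. h k j) \<in> J \<rightarrow> carrier M" "h i \<in> J \<rightarrow> carrier M"
    using insert.prems by (auto intro!: M.finsum_closed)
  have "(\<Oplus>\<^bsub>M\<^esub>k\<in>insert i I. \<Oplus>\<^bsub>M\<^esub>j\<in>J. h k j)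
      = (\<Oplus>\<^bsub>M\<^esub>j\<in>J. h i j) \<oplus>\<^bsub>M\<^esub> (\<Oplus>\<^bsub>M\<^esub>j\<in>J. \<Oplus>\<^bsub>M\<^esub>k\<in>I. h k j)"
    using insert cl by (subst M.finsum_insert) auto
  also have "\<dots> = (\<Oplus>\<^bsub>M\<^esub>j\<in>J. h i j \<oplus>\<^bsub>M\<^esub> (\<Oplus>\<^bsub>M\<^esub>k\<in>I. h k j))"
    using cl by (intro M.finsum_addf[symmetric]) auto
  also have "\<dots> = (\<Oplus>\<^bsub>M\<^esub>j\<in>J. \<Oplus>\<^bsub>M\<^esub>k\<in>insert i I. h k j)"
    using insert.hyps insert.prems
    by (intro M.finsum_cong') (auto intro!: M.finsum_closed M.finsum_insert[symmetric])
  finally show ?case .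
qed

text \<open>Provides the submodule generated by the finitely many relations that are later divided
  out. Closure holds because sums and multiples of combinations come from pointwise sums and left
  multiples of the coefficient functions.\<close>

lemma linear_combinations_submodule:
  assumes "finite I" "h \<in> I \<rightarrow> carrier M"
  shows "submodule {\<Oplus>\<^bsub>M\<^esub>i\<in>I. y i \<odot>\<^bsub>M\<^esub> h i | y. y \<in> I \<rightarrow> carrier R} R M"
    (is "submodule {?c y | y. ?Y y} R M")
proof (rule submodule_leftI)
  have h: "h i \<in> carrier M" if "i \<in> I" for i using assms(2) that by blast
  then have cl: "(\<lambda>i. y i \<odot>\<^bsub>M\<^esub> h i) \<in> I \<rightarrow> carrier M" if "?Y y" for y using that by auto
  show "{?c y | y. ?Y y} \<subseteq> carrier M" using cl by (auto intro: M.finsum_closed)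
  have "(\<Oplus>\<^bsub>M\<^esub>i\<in>I. \<zero> \<odot>\<^bsub>M\<^esub> h i) = (\<Oplus>\<^bsub>M\<^esub>i\<in>I. \<zero>\<^bsub>M\<^esub>)"
    using h by (intro M.finsum_cong') auto
  then have "\<zero>\<^bsub>M\<^esub> = ?c (\<lambda>_. \<zero>)" by (simp add: M.finsum_zero)
  then show "\<zero>\<^bsub>M\<^esub> \<in> {?c y | y. ?Y y}"
    by (intro CollectI exI[of _ "\<lambda>_. \<zero>"]) auto
next
  have h: "h i \<in> carrier M" if "i \<in> I" for i using assms(2) that by blast
  fix u v assume "u \<in> {?c y | y. ?Y y}" "v \<in> {?c y | y. ?Y y}"
  then obtain y z where yz: "u = ?c y" "?Y y" "v = ?c z" "?Y z" by blast
  have "?c (\<lambda>i. y i \<oplus> z i) = (\<Oplus>\<^bsub>M\<^esub>i\<in>I. y i \<odot>\<^bsub>M\<^esub> h i \<oplus>\<^bsub>M\<^esub> z i \<odot>\<^bsub>M\<^esub> h i)"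
    using yz h by (intro M.finsum_cong') (auto simp: smult_l_distr Pi_iff)
  also have "\<dots> = u \<oplus>\<^bsub>M\<^esub> v"
    unfolding yz using yz h by (intro M.finsum_addf) auto
  finally have "u \<oplus>\<^bsub>M\<^esub> v = ?c (\<lambda>i. y i \<oplus> z i)" by simp
  moreover have "?Y (\<lambda>i. y i \<oplus> z i)" using yz by auto
  ultimately show "u \<oplus>\<^bsub>M\<^esub> v \<in> {?c y | y. ?Y y}" by (intro CollectI exI conjI)
next
  have h: "h i \<in> carrier M" if "i \<in> I" for i using assms(2) that by blast
  fix a u assume a: "a \<in> carrier R" and "u \<in> {?c y | y. ?Y y}"
  then obtain y where y: "u = ?c y" "?Y y" by blast
  have "a \<odot>\<^bsub>M\<^esub> u = (\<Oplus>\<^bsub>M\<^esub>i\<in>I. a \<odot>\<^bsub>M\<^esub> (y i \<odot>\<^bsub>M\<^esub> h i))"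
    unfolding y using assms(1) a y h by (intro finsum_smult) auto
  also have "\<dots> = ?c (\<lambda>i. a \<otimes> y i)"
    using a y h by (intro M.finsum_cong') (auto simp: smult_assoc1 Pi_iff)
  finally have "a \<odot>\<^bsub>M\<^esub> u = ?c (\<lambda>i. a \<otimes> y i)" .
  moreover have "?Y (\<lambda>i. a \<otimes> y i)" using a y by auto
  ultimately show "a \<odot>\<^bsub>M\<^esub> u \<in> {?c y | y. ?Y y}" by (intro CollectI exI conjI)
qed

text \<open>The quotient is carried by a system of representatives of the cosets.\<close>

lemma quotient_module_exists:
  assumes "submodule S R M"
  shows "\<exists>(N :: ('r, 'm) module) q. left_module R N \<and> q \<in> left_module_hom R M N \<and>
    (\<forall>x\<in>carrier M. \<forall>y\<in>carrier M. q x = q y \<longleftrightarrow> x \<ominus>\<^bsub>M\<^esub> y \<in> S)"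
proof -
  interpret S: subgroup S "add_monoid M" using assms by (rule submodule.axioms)
  have S: "S \<subseteq> carrier M" "\<zero>\<^bsub>M\<^esub> \<in> S" "\<And>x y. \<lbrakk>x \<in> S; y \<in> S\<rbrakk> \<Longrightarrow> x \<oplus>\<^bsub>M\<^esub> y \<in> S"
    "\<And>r x. \<lbrakk>r \<in> carrier R; x \<in> S\<rbrakk> \<Longrightarrow> r \<odot>\<^bsub>M\<^esub> x \<in> S"
    "\<And>x. x \<in> S \<Longrightarrow> \<ominus>\<^bsub>M\<^esub> x \<in> S"
    using S.subset S.one_closed S.m_closed submodule.smult_closed[OF assms] S.m_inv_closed
    by (auto simp: a_inv_def)
  \<comment> \<open>Choosing a representative, rather than forming the coset as a set, keeps the
    quotient in the type of \<open>M\<close>.\<close>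
  define q where "q x = (SOME y. y \<in> carrier M \<and> x \<ominus>\<^bsub>M\<^esub> y \<in> S)" for x
  have sym: "y \<ominus>\<^bsub>M\<^esub> x \<in> S" if "x \<ominus>\<^bsub>M\<^esub> y \<in> S" "x \<in> carrier M" "y \<in> carrier M" for x y
  proof -
    have "y \<ominus>\<^bsub>M\<^esub> x = \<ominus>\<^bsub>M\<^esub> (x \<ominus>\<^bsub>M\<^esub> y)"
      using that by (simp add: a_minus_def M.minus_add M.a_ac)
    then show ?thesis using S(5) that by simp
  qed
  have trans: "x \<ominus>\<^bsub>M\<^esub> z \<in> S" if "x \<ominus>\<^bsub>M\<^esub> y \<in> S" "y \<ominus>\<^bsub>M\<^esub> z \<in> S"
    "x \<in> carrier M" "y \<in> carrier M" "z \<in> carrier M" for x y z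
  proof -
    have "x \<ominus>\<^bsub>M\<^esub> z = (x \<ominus>\<^bsub>M\<^esub> y) \<oplus>\<^bsub>M\<^esub> (y \<ominus>\<^bsub>M\<^esub> z)"
      using that by (simp add: a_minus_def M.a_assoc M.r_neg1)
    then show ?thesis using S(3) that by simp
  qed
  have q: "q x \<in> carrier M" "x \<ominus>\<^bsub>M\<^esub> q x \<in> S" if "x \<in> carrier M" for x
  proof -
    have "x \<in> carrier M \<and> x \<ominus>\<^bsub>M\<^esub> x \<in> S" using that S(2) by (simp add: a_minus_def M.r_neg)
    then show "q x \<in> carrier M" "x \<ominus>\<^bsub>M\<^esub> q x \<in> S" unfolding q_def by (metis (mono_tags, lifting) someI)+
  qed
  have q_eq: "q x = q y \<longleftrightarrow> x \<ominus>\<^bsub>M\<^esub> y \<in> S" if "x \<in> carrier M" "y \<in> carrier M" for x y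
  proof
    assume "q x = q y"
    then show "x \<ominus>\<^bsub>M\<^esub> y \<in> S" using q[OF that(1)] q[OF that(2)] sym trans that by metis
  next
    assume "x \<ominus>\<^bsub>M\<^esub> y \<in> S"
    \<comment> \<open>Congruent elements satisfy the same defining predicate, so the choice operator
      picks the same representative for both.\<close>
    then have "(z \<in> carrier M \<and> x \<ominus>\<^bsub>M\<^esub> z \<in> S) = (z \<in> carrier M \<and> y \<ominus>\<^bsub>M\<^esub> z \<in> S)" for z
      using sym trans that by metis
    then show "q x = q y" by (simp add: q_def)
  qed
  have qq: "q (q x) = q x" if "x \<in> carrier M" for x using that q sym by (simp add: q_eq)
  \<comment> \<open>The quotient computes in \<open>M\<close> and then applies \<open>q\<close>.
    This rule and the next ones erase an inner \<open>q\<close>, so that every module law of the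
    quotient reduces to the same law in \<open>M\<close>.\<close>
  have q_add: "q (q x \<oplus>\<^bsub>M\<^esub> y) = q (x \<oplus>\<^bsub>M\<^esub> y)" "q (y \<oplus>\<^bsub>M\<^esub> q x) = q (y \<oplus>\<^bsub>M\<^esub> x)"
    if "x \<in> carrier M" "y \<in> carrier M" for x y
  proof -
    have "(q x \<oplus>\<^bsub>M\<^esub> y) \<ominus>\<^bsub>M\<^esub> (x \<oplus>\<^bsub>M\<^esub> y) = (q x \<ominus>\<^bsub>M\<^esub> x) \<oplus>\<^bsub>M\<^esub> (y \<oplus>\<^bsub>M\<^esub> \<ominus>\<^bsub>M\<^esub> y)"
      using that q(1)[OF that(1)] by (simp add: a_minus_def M.minus_add M.a_ac)
    then have "(q x \<oplus>\<^bsub>M\<^esub> y) \<ominus>\<^bsub>M\<^esub> (x \<oplus>\<^bsub>M\<^esub> y) = q x \<ominus>\<^bsub>M\<^esub> x"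
      using that q(1)[OF that(1)] by (simp add: M.r_neg)
    then show "q (q x \<oplus>\<^bsub>M\<^esub> y) = q (x \<oplus>\<^bsub>M\<^esub> y)" using that q sym by (simp add: q_eq)
    then show "q (y \<oplus>\<^bsub>M\<^esub> q x) = q (y \<oplus>\<^bsub>M\<^esub> x)" using that q by (simp add: M.a_comm)
  qed
  have q_add_add: "q (x \<oplus>\<^bsub>M\<^esub> (q y \<oplus>\<^bsub>M\<^esub> z)) = q (x \<oplus>\<^bsub>M\<^esub> (y \<oplus>\<^bsub>M\<^esub> z))"
      "q (x \<oplus>\<^bsub>M\<^esub> (z \<oplus>\<^bsub>M\<^esub> q y)) = q (x \<oplus>\<^bsub>M\<^esub> (z \<oplus>\<^bsub>M\<^esub> y))"
    if "x \<in> carrier M" "y \<in> carrier M" "z \<in> carrier M" for x y z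
  proof -
    show "q (x \<oplus>\<^bsub>M\<^esub> (q y \<oplus>\<^bsub>M\<^esub> z)) = q (x \<oplus>\<^bsub>M\<^esub> (y \<oplus>\<^bsub>M\<^esub> z))"
      using that q(1)[OF that(2)] q_add(2)[of "q y \<oplus>\<^bsub>M\<^esub> z" x] q_add(2)[of "y \<oplus>\<^bsub>M\<^esub> z" x]
      by (simp add: q_add(1)[OF that(2,3)])
    then show "q (x \<oplus>\<^bsub>M\<^esub> (z \<oplus>\<^bsub>M\<^esub> q y)) = q (x \<oplus>\<^bsub>M\<^esub> (z \<oplus>\<^bsub>M\<^esub> y))"
      using that q(1)[OF that(2)] by (simp add: M.a_comm)
  qed
  have q_smult: "q (a \<odot>\<^bsub>M\<^esub> q x) = q (a \<odot>\<^bsub>M\<^esub> x)" if "a \<in> carrier R" "x \<in> carrier M" for a x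
  proof -
    have "a \<odot>\<^bsub>M\<^esub> q x \<ominus>\<^bsub>M\<^esub> a \<odot>\<^bsub>M\<^esub> x = a \<odot>\<^bsub>M\<^esub> (q x \<ominus>\<^bsub>M\<^esub> x)"
      using that q(1)[OF that(2)] by (simp add: a_minus_def smult_r_distr smult_minus)
    then show ?thesis using that q sym S(4) by (simp add: q_eq)
  qed
  have q_smult_smult: "q (a \<odot>\<^bsub>M\<^esub> (b \<odot>\<^bsub>M\<^esub> q x)) = q (a \<odot>\<^bsub>M\<^esub> (b \<odot>\<^bsub>M\<^esub> x))"
      "q (a \<odot>\<^bsub>M\<^esub> q x \<oplus>\<^bsub>M\<^esub> b \<odot>\<^bsub>M\<^esub> q x) = q (a \<odot>\<^bsub>M\<^esub> x \<oplus>\<^bsub>M\<^esub> b \<odot>\<^bsub>M\<^esub> x)"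
    if "a \<in> carrier R" "b \<in> carrier R" "x \<in> carrier M" for a b x
    using that q(1) q_smult[of "a \<otimes> b" x] q_smult[of "a \<oplus> b" x]
    by (simp_all add: smult_assoc1 smult_l_distr)
  define N :: "('r, 'm) module" where "N = \<lparr>carrier = q ` carrier M,
    monoid.mult = (\<lambda>_ _. undefined), one = undefined, ring.zero = q \<zero>\<^bsub>M\<^esub>,
    ring.add = (\<lambda>x y. q (x \<oplus>\<^bsub>M\<^esub> y)), smult = (\<lambda>r x. q (r \<odot>\<^bsub>M\<^esub> x))\<rparr>"
  have "abelian_group N"
  proof (rule abelian_groupI)
    fix x assume "x \<in> carrier N"
    then obtain x' where x': "x' \<in> carrier M" "x = q x'" by (auto simp: N_def)
    show "\<exists>y\<in>carrier N. y \<oplus>\<^bsub>N\<^esub> x = \<zero>\<^bsub>N\<^esub>"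
      by (rule bexI[of _ "q (\<ominus>\<^bsub>M\<^esub> x')"]) (use x' q in \<open>auto simp: N_def q_add M.l_neg\<close>)
  qed (use q in \<open>auto simp: N_def q_add q_add_add qq M.a_ac\<close>)
  moreover have "left_module_axioms R N"
    by unfold_locales
      (use q in \<open>auto simp: N_def q_add qq q_smult q_smult_smult smult_l_distr smult_r_distr smult_assoc1\<close>)
  ultimately have "left_module R N" using R.ring_axioms by (auto simp: left_module_def)
  moreover have "q \<in> left_module_hom R M N"
    using q by (auto simp: left_module_hom_def N_def q_add q_smult)
  ultimately show ?thesis using q_eq by blast
qed

end


section \<open>Solvability of consistent systems\<close>

text \<open>The product of \<open>M\<close> with one copy of \<open>R\<close> for each index; for an
  infinite index type this is the full product, not a free module. With indices in
  \<open>nat\<close>, one type serves systems with any number of unknowns.\<close>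

definition adjoin_variables ::
  "('r, 'x) ring_scheme \<Rightarrow> ('r, 'm, 'y) module_scheme \<Rightarrow> ('r, 'm \<times> ('i \<Rightarrow> 'r)) module" where
  "adjoin_variables R M = \<lparr>carrier = carrier M \<times> (UNIV \<rightarrow> carrier R),
    monoid.mult = (\<lambda>_ _. undefined), one = undefined, ring.zero = (\<zero>\<^bsub>M\<^esub>, \<lambda>_. \<zero>\<^bsub>R\<^esub>),
    ring.add = (\<lambda>p q. (fst p \<oplus>\<^bsub>M\<^esub> fst q, \<lambda>j. snd p j \<oplus>\<^bsub>R\<^esub> snd q j)),
    smult = (\<lambda>r p. (r \<odot>\<^bsub>M\<^esub> fst p, \<lambda>j. r \<otimes>\<^bsub>R\<^esub> snd p j))\<rparr>"

context left_module
begin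

lemma adjoin_variables_left_module: "left_module R (adjoin_variables R M)"
proof -
  let ?L = "adjoin_variables R M"
  have "abelian_group ?L"
  proof (rule abelian_groupI)
    fix x assume "x \<in> carrier ?L"
    then show "\<exists>y\<in>carrier ?L. y \<oplus>\<^bsub>?L\<^esub> x = \<zero>\<^bsub>?L\<^esub>"
      by (intro bexI[of _ "(\<ominus>\<^bsub>M\<^esub> fst x, \<lambda>j. \<ominus> snd x j)"])
        (auto simp: adjoin_variables_def M.l_neg R.l_neg Pi_iff)
  qed (auto simp: adjoin_variables_def M.a_ac R.a_ac Pi_iff)
  moreover have "left_module_axioms R ?L"
    by unfold_locales (auto simp: adjoin_variables_def Pi_iff smult_l_distr smult_r_distr
        smult_assoc1 R.l_distr R.r_distr R.m_assoc)
  ultimately show ?thesis using R.ring_axioms by (auto simp: left_module_def)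
qed

text \<open>Since the operations are componentwise, an equation in the extension can be read as one
  equation in \<open>M\<close> and one in \<open>R\<close> for each coordinate.\<close>

lemma finsum_adjoin_variables:
  assumes "finite I" "h \<in> I \<rightarrow> carrier (adjoin_variables R M)"
  shows "(\<Oplus>\<^bsub>adjoin_variables R M\<^esub>i\<in>I. h i) = (\<Oplus>\<^bsub>M\<^esub>i\<in>I. fst (h i), \<lambda>j. \<Oplus>i\<in>I. snd (h i) j)"
  using assms
proof (induction I rule: finite_induct)
  case empty
  interpret L: left_module R "adjoin_variables R M" by (rule adjoin_variables_left_module)
  show ?case by (simp add: adjoin_variables_def L.M.finsum_empty[unfolded adjoin_variables_def])
next
  case (insert i I)
  interpret L: left_module R "adjoin_variables R M" by (rule adjoin_variables_left_module)
  have h: "fst (h k) \<in> carrier M" "snd (h k) j \<in> carrier R" if "k \<in> insert i I" for k j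
    using Pi_mem[OF insert.prems that] by (auto simp: adjoin_variables_def Pi_iff)
  have "(\<Oplus>\<^bsub>adjoin_variables R M\<^esub>i\<in>insert i I. h i)
      = h i \<oplus>\<^bsub>adjoin_variables R M\<^esub> (\<Oplus>\<^bsub>adjoin_variables R M\<^esub>i\<in>I. h i)"
    using insert by (intro L.M.finsum_insert) auto
  also have "\<dots> = h i \<oplus>\<^bsub>adjoin_variables R M\<^esub> (\<Oplus>\<^bsub>M\<^esub>i\<in>I. fst (h i), \<lambda>j. \<Oplus>i\<in>I. snd (h i) j)"
    using insert by auto
  finally show ?case using insert.hyps h by (simp add: adjoin_variables_def Pi_iff)
qed

text \<open>Adjoin a solution \<open>c\<close> freely: the system forces the relations \<open>d\<^sub>i = A\<^sub>i c\<close>, and consistency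
  says exactly that \<open>M\<close> still embeds into the quotient by these relations.\<close>

lemma absolutely_pure_solvable:
  fixes n m :: nat
  assumes pure: "absolutely_pure R M"
    and A: "A \<in> {..<n} \<rightarrow> {..<m} \<rightarrow> carrier R" and d: "d \<in> {..<n} \<rightarrow> carrier M"
    and consistent: "\<And>y. \<lbrakk>y \<in> {..<n} \<rightarrow> carrier R; \<And>j. j < m \<Longrightarrow> (\<Oplus>i\<in>{..<n}. y i \<otimes> A i j) = \<zero>\<rbrakk>
      \<Longrightarrow> (\<Oplus>\<^bsub>M\<^esub>i\<in>{..<n}. y i \<odot>\<^bsub>M\<^esub> d i) = \<zero>\<^bsub>M\<^esub>"
  shows "\<exists>c \<in> {..<m} \<rightarrow> carrier M. \<forall>i<n. (\<Oplus>\<^bsub>M\<^esub>j\<in>{..<m}. A i j \<odot>\<^bsub>M\<^esub> c j) = d i"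
proof -
  define L :: "('r, 'm \<times> (nat \<Rightarrow> 'r)) module" where "L = adjoin_variables R M"
  interpret L: left_module R L unfolding L_def by (rule adjoin_variables_left_module)
  have A': "A i j \<in> carrier R" if "i < n" "j < m" for i j
    using Pi_mem[OF Pi_mem[OF A]] that by simp
  have d': "d i \<in> carrier M" if "i < n" for i using d that by auto
  \<comment> \<open>\<open>s i\<close> is the formal difference of \<open>d i\<close> and row
    \<open>i\<close> of the system. The default \<open>\<zero>\<close> keeps the coordinates from
    \<open>m\<close> on out of every relation.\<close>
  define s where "s i = (d i, \<lambda>j. if j < m then \<ominus> A i j else \<zero>)" for i
  define S where "S = {\<Oplus>\<^bsub>L\<^esub>i\<in>{..<n}. y i \<odot>\<^bsub>L\<^esub> s i | y. y \<in> {..<n} \<rightarrow> carrier R}"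
  have s: "s i \<in> carrier L" if "i < n" for i
    using that A' d' by (auto simp: s_def L_def adjoin_variables_def)
  have "submodule S R L"
    unfolding S_def by (rule L.linear_combinations_submodule) (simp_all add: s)
  from L.quotient_module_exists[OF this]
  obtain N :: "('r, 'm \<times> (nat \<Rightarrow> 'r)) module" and q where N: "left_module R N"
    and q: "q \<in> left_module_hom R L N"
    and "\<forall>x\<in>carrier L. \<forall>y\<in>carrier L. q x = q y \<longleftrightarrow> x \<ominus>\<^bsub>L\<^esub> y \<in> S"
    by (elim exE conjE) (rule that)
  then have q_eq: "q x = q y \<longleftrightarrow> x \<ominus>\<^bsub>L\<^esub> y \<in> S" if "x \<in> carrier L" "y \<in> carrier L" for x y
    using that by simp
  interpret N: left_module R N by fact
  have q_carrier: "q x \<in> carrier N" if "x \<in> carrier L" for x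
    using q that unfolding left_module_hom_def by blast
  have q_add: "q (x \<oplus>\<^bsub>L\<^esub> y) = q x \<oplus>\<^bsub>N\<^esub> q y" if "x \<in> carrier L" "y \<in> carrier L" for x y
    using q that unfolding left_module_hom_def by blast
  have q_smult: "q (r \<odot>\<^bsub>L\<^esub> x) = r \<odot>\<^bsub>N\<^esub> q x" if "r \<in> carrier R" "x \<in> carrier L" for r x
    using q that unfolding left_module_hom_def by blast
  define f where "f x = q (x, \<lambda>_. \<zero>)" for x
  have emb: "(x, \<lambda>_. \<zero>) \<in> carrier L" if "x \<in> carrier M" for x
    using that by (simp add: L_def adjoin_variables_def)
  have f: "f \<in> left_module_hom R M N"
    unfolding left_module_hom_def
  proof (intro CollectI conjI ballI Pi_I)
    fix x assume x: "x \<in> carrier M"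
    then show "f x \<in> carrier N" using emb q_carrier unfolding f_def by blast
    fix y assume y: "y \<in> carrier M"
    have "(x \<oplus>\<^bsub>M\<^esub> y, \<lambda>_. \<zero>) = (x, \<lambda>_. \<zero>) \<oplus>\<^bsub>L\<^esub> (y, \<lambda>_. \<zero>)"
      by (simp add: L_def adjoin_variables_def)
    then show "f (x \<oplus>\<^bsub>M\<^esub> y) = f x \<oplus>\<^bsub>N\<^esub> f y"
      using q_add[OF emb[OF x] emb[OF y]] by (simp only: f_def)
  next
    fix r x assume r: "r \<in> carrier R" and x: "x \<in> carrier M"
    have "(r \<odot>\<^bsub>M\<^esub> x, \<lambda>_. \<zero>) = r \<odot>\<^bsub>L\<^esub> (x, \<lambda>_. \<zero>)"
      using r by (simp add: L_def adjoin_variables_def)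
    then show "f (r \<odot>\<^bsub>M\<^esub> x) = r \<odot>\<^bsub>N\<^esub> f x"
      using q_smult[OF r emb[OF x]] by (simp only: f_def)
  qed
  have minus: "u \<ominus>\<^bsub>L\<^esub> v = (fst u \<ominus>\<^bsub>M\<^esub> fst v, \<lambda>j. snd u j \<ominus> snd v j)"
    if "u \<in> carrier L" "v \<in> carrier L" for u v
  proof -
    have "\<ominus>\<^bsub>L\<^esub> v = (\<ominus>\<^bsub>M\<^esub> fst v, \<lambda>j. \<ominus> snd v j)"
      using that by (intro L.M.minus_equality)
        (auto simp: L_def adjoin_variables_def M.l_neg R.l_neg Pi_iff)
    then show ?thesis by (simp add: a_minus_def L_def adjoin_variables_def)
  qed
  \<comment> \<open>If two elements of \<open>M\<close> are identified, their difference is a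
    combination of the \<open>s i\<close> with coefficients \<open>y\<close>. The variable
    coordinates say that \<open>y\<close> annihilates every column of \<open>A\<close>; the
    component in \<open>M\<close> says that the difference is the combination of the
    \<open>d i\<close>, which is zero by consistency.\<close>
  have "inj_on f (carrier M)"
  proof (rule inj_onI)
    fix x x' assume x: "x \<in> carrier M" "x' \<in> carrier M" and "f x = f x'"
    then have "(x, \<lambda>_. \<zero>) \<ominus>\<^bsub>L\<^esub> (x', \<lambda>_. \<zero>) \<in> S" by (simp add: f_def q_eq emb)
    then obtain y where y: "y \<in> {..<n} \<rightarrow> carrier R"
      and E0: "(x \<ominus>\<^bsub>M\<^esub> x', \<lambda>_. \<zero> \<ominus> \<zero>) = (\<Oplus>\<^bsub>L\<^esub>i\<in>{..<n}. y i \<odot>\<^bsub>L\<^esub> s i)"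
      using x by (auto simp: S_def minus emb)
    have cl: "(\<lambda>i. y i \<odot>\<^bsub>L\<^esub> s i) \<in> {..<n} \<rightarrow> carrier L"
      using y s by (intro Pi_I L.smult_closed) auto
    note E0
    also have "(\<Oplus>\<^bsub>L\<^esub>i\<in>{..<n}. y i \<odot>\<^bsub>L\<^esub> s i)
        = (\<Oplus>\<^bsub>M\<^esub>i\<in>{..<n}. fst (y i \<odot>\<^bsub>L\<^esub> s i), \<lambda>j. \<Oplus>i\<in>{..<n}. snd (y i \<odot>\<^bsub>L\<^esub> s i) j)"
      using cl unfolding L_def by (intro finsum_adjoin_variables) simp_all
    finally have E: "(x \<ominus>\<^bsub>M\<^esub> x', \<lambda>_. \<zero> \<ominus> \<zero>)
        = (\<Oplus>\<^bsub>M\<^esub>i\<in>{..<n}. fst (y i \<odot>\<^bsub>L\<^esub> s i), \<lambda>j. \<Oplus>i\<in>{..<n}. snd (y i \<odot>\<^bsub>L\<^esub> s i) j)" .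
    have eq: "x \<ominus>\<^bsub>M\<^esub> x' = (\<Oplus>\<^bsub>M\<^esub>i\<in>{..<n}. y i \<odot>\<^bsub>M\<^esub> d i)"
      using arg_cong[OF E, of fst] by (simp add: L_def adjoin_variables_def s_def)
    have eq': "(\<Oplus>i\<in>{..<n}. y i \<otimes> (if j < m then \<ominus> A i j else \<zero>)) = \<zero>" for j
      using fun_cong[OF arg_cong[OF E, of snd], of j, symmetric]
      by (simp add: L_def adjoin_variables_def s_def a_minus_def)
    have "(\<Oplus>i\<in>{..<n}. y i \<otimes> A i j) = \<zero>" if "j < m" for j
    proof -
      have t: "(\<lambda>i. y i \<otimes> A i j) \<in> {..<n} \<rightarrow> carrier R" using y A' that by auto
      \<comment> \<open>The sign of the entries of \<open>s\<close> is moved to a common right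
        factor \<open>\<ominus> \<one>\<close>, which distributivity takes out of the sum.\<close>
      have "\<zero> = (\<Oplus>i\<in>{..<n}. y i \<otimes> \<ominus> A i j)" using eq'[of j] that by simp
      also have "\<dots> = (\<Oplus>i\<in>{..<n}. y i \<otimes> A i j \<otimes> \<ominus> \<one>)"
        using that y A' by (intro R.finsum_cong') (auto simp: Pi_iff R.r_minus)
      also have "\<dots> = (\<Oplus>i\<in>{..<n}. y i \<otimes> A i j) \<otimes> \<ominus> \<one>"
        using t by (simp add: R.finsum_ldistr)
      also have "\<dots> = \<ominus> (\<Oplus>i\<in>{..<n}. y i \<otimes> A i j)"
        using R.finsum_closed[OF t] by (simp add: R.r_minus)
      finally show ?thesis using R.finsum_closed[OF t] by (metis R.minus_minus R.minus_zero)
    qed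
    then have "x \<ominus>\<^bsub>M\<^esub> x' = \<zero>\<^bsub>M\<^esub>" using consistent[OF y] eq by simp
    moreover have "x = (x \<ominus>\<^bsub>M\<^esub> x') \<oplus>\<^bsub>M\<^esub> x'"
      using x by (simp add: a_minus_def M.a_assoc M.l_neg)
    ultimately show "x = x'" using x by simp
  qed
  \<comment> \<open>\<open>N\<close> does not have the carrier type fixed in
    \<open>absolutely_pure\<close>, hence the appeal to the version for extensions of arbitrary
    type.\<close>
  then have P: "pure_submodule (f ` carrier M) R N"
    using absolutely_pureD[OF left_module_axioms pure N f] by blast
  \<comment> \<open>The adjoined variables: the classes of the unit vectors solve the system in the
    quotient.\<close>
  define e :: "nat \<Rightarrow> 'm \<times> (nat \<Rightarrow> 'r)" where "e j = (\<zero>\<^bsub>M\<^esub>, \<lambda>k. if k = j then \<one> else \<zero>)" for j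
  have e: "e j \<in> carrier L" for j by (auto simp: e_def L_def adjoin_variables_def)
  have sol: "(\<Oplus>\<^bsub>N\<^esub>j\<in>{..<m}. A i j \<odot>\<^bsub>N\<^esub> q (e j)) = f (d i)" if i: "i < n" for i
  proof -
    have cl: "(\<lambda>j. A i j \<odot>\<^bsub>L\<^esub> e j) \<in> {..<m} \<rightarrow> carrier L" using A' i e by auto
    have "(\<Oplus>\<^bsub>N\<^esub>j\<in>{..<m}. A i j \<odot>\<^bsub>N\<^esub> q (e j)) = (\<Oplus>\<^bsub>N\<^esub>j\<in>{..<m}. q (A i j \<odot>\<^bsub>L\<^esub> e j))"
      using e A' i q_carrier by (intro N.finsum_cong') (auto simp: q_smult)
    also have "\<dots> = q (\<Oplus>\<^bsub>L\<^esub>j\<in>{..<m}. A i j \<odot>\<^bsub>L\<^esub> e j)"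
      using left_module_hom_finsum[OF L.left_module_axioms N q _ cl] by simp
    also have "(\<Oplus>\<^bsub>L\<^esub>j\<in>{..<m}. A i j \<odot>\<^bsub>L\<^esub> e j)
        = (\<Oplus>\<^bsub>M\<^esub>j\<in>{..<m}. fst (A i j \<odot>\<^bsub>L\<^esub> e j), \<lambda>k. \<Oplus>j\<in>{..<m}. snd (A i j \<odot>\<^bsub>L\<^esub> e j) k)"
      using cl unfolding L_def by (intro finsum_adjoin_variables) simp_all
    \<comment> \<open>Combining the unit vectors with the coefficients of row \<open>i\<close>
      reproduces that row as a vector of coordinates.\<close>
    also have "\<dots> = (\<zero>\<^bsub>M\<^esub>, \<lambda>k. if k < m then A i k else \<zero>)"
    proof -
      have "(\<Oplus>\<^bsub>M\<^esub>j\<in>{..<m}. fst (A i j \<odot>\<^bsub>L\<^esub> e j)) = (\<Oplus>\<^bsub>M\<^esub>j\<in>{..<m}. \<zero>\<^bsub>M\<^esub>)"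
        using A' i by (intro M.finsum_cong') (auto simp: e_def L_def adjoin_variables_def)
      moreover have "(\<Oplus>j\<in>{..<m}. snd (A i j \<odot>\<^bsub>L\<^esub> e j) k) = (if k < m then A i k else \<zero>)" for k
      proof -
        have "(\<Oplus>j\<in>{..<m}. snd (A i j \<odot>\<^bsub>L\<^esub> e j) k) = (\<Oplus>j\<in>{..<m}. if k = j then A i j else \<zero>)"
          using A' i by (intro R.finsum_cong') (auto simp: e_def L_def adjoin_variables_def)
        also have "\<dots> = (if k < m then A i k else \<zero>)"
        proof (cases "k < m")
          case True
          then show ?thesis using A' i by (simp add: R.finsum_singleton)
        next
          case False
          then have "(\<Oplus>j\<in>{..<m}. if k = j then A i j else \<zero>) = (\<Oplus>j\<in>{..<m}. \<zero>)"
            by (intro R.finsum_cong') auto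
          then show ?thesis using False by (simp add: R.finsum_zero)
        qed
        finally show ?thesis .
      qed
      ultimately show ?thesis by (simp add: M.finsum_zero)
    qed
    also have "q \<dots> = f (d i)"
    proof -
      have cl': "(\<zero>\<^bsub>M\<^esub>, \<lambda>k. if k < m then A i k else \<zero>) \<in> carrier L"
        using A' i by (auto simp: L_def adjoin_variables_def)
      \<comment> \<open>The two sides of equation \<open>i\<close> differ by \<open>s i\<close>,
        which lies in \<open>S\<close> as the combination whose coefficients form the unit vector at
        \<open>i\<close>; hence \<open>q\<close> identifies them.\<close>
      have "(d i, \<lambda>_. \<zero>) \<ominus>\<^bsub>L\<^esub> (\<zero>\<^bsub>M\<^esub>, \<lambda>k. if k < m then A i k else \<zero>) = s i"
        using minus[OF emb[OF d'[OF i]] cl'] d'[OF i] A' i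
        by (auto simp: s_def a_minus_def fun_eq_iff)
      also have "s i = (\<Oplus>\<^bsub>L\<^esub>k\<in>{..<n}. if i = k then s k else \<zero>\<^bsub>L\<^esub>)"
        using i s by (intro L.M.finsum_singleton[symmetric]) auto
      also have "\<dots> = (\<Oplus>\<^bsub>L\<^esub>k\<in>{..<n}. (if i = k then \<one> else \<zero>) \<odot>\<^bsub>L\<^esub> s k)"
        using s by (intro L.M.finsum_cong') auto
      also have "\<dots> \<in> S" unfolding S_def by (intro CollectI exI conjI) (rule refl, auto)
      finally show ?thesis
        using q_eq[OF emb[OF d'[OF i]] cl'] by (simp add: f_def)
    qed
    finally show ?thesis .
  qed
  have "\<exists>c\<in>{..<m} \<rightarrow> f ` carrier M. \<forall>i<n. (\<Oplus>\<^bsub>N\<^esub>j\<in>{..<m}. A i j \<odot>\<^bsub>N\<^esub> c j) = f (d i)"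
  proof (rule P[unfolded pure_submodule_def, THEN conjunct2, rule_format], intro conjI)
    show "\<exists>c\<in>{..<m} \<rightarrow> carrier N. \<forall>i<n. (\<Oplus>\<^bsub>N\<^esub>j\<in>{..<m}. A i j \<odot>\<^bsub>N\<^esub> c j) = f (d i)"
      using sol q_carrier e by (intro bexI[of _ "\<lambda>j. q (e j)"]) auto
  qed (use A d in auto)
  then obtain c where c: "c \<in> {..<m} \<rightarrow> f ` carrier M"
    and csol: "\<And>i. i < n \<Longrightarrow> (\<Oplus>\<^bsub>N\<^esub>j\<in>{..<m}. A i j \<odot>\<^bsub>N\<^esub> c j) = f (d i)" by blast
  \<comment> \<open>Purity puts a solution into the image of \<open>M\<close>. Its preimages solve
    the original system because \<open>f\<close> is injective and commutes with the finite
    sums.\<close>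
  define b where "b j = inv_into (carrier M) f (c j)" for j
  have b: "b j \<in> carrier M" "f (b j) = c j" if "j < m" for j
    using Pi_mem[OF c, of j] that by (auto simp: b_def inv_into_into f_inv_into_f)
  show ?thesis
  proof (intro bexI[of _ b] allI impI)
    fix i assume i: "i < n"
    have cl: "(\<lambda>j. A i j \<odot>\<^bsub>M\<^esub> b j) \<in> {..<m} \<rightarrow> carrier M" using A' b i by auto
    have fM: "f x \<in> carrier N" if "x \<in> carrier M" for x
      using f that by (auto simp: left_module_hom_def)
    have "f (\<Oplus>\<^bsub>M\<^esub>j\<in>{..<m}. A i j \<odot>\<^bsub>M\<^esub> b j) = (\<Oplus>\<^bsub>N\<^esub>j\<in>{..<m}. f (A i j \<odot>\<^bsub>M\<^esub> b j))"
      using left_module_hom_finsum[OF left_module_axioms N f _ cl] by simp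
    also have "\<dots> = (\<Oplus>\<^bsub>N\<^esub>j\<in>{..<m}. A i j \<odot>\<^bsub>N\<^esub> c j)"
    proof (rule N.finsum_cong')
      show "(\<lambda>j. A i j \<odot>\<^bsub>N\<^esub> c j) \<in> {..<m} \<rightarrow> carrier N"
        using A' i b(1) fM by (auto simp flip: b(2) intro!: N.smult_closed)
      fix j assume "j \<in> {..<m}"
      then show "f (A i j \<odot>\<^bsub>M\<^esub> b j) = A i j \<odot>\<^bsub>N\<^esub> c j"
        using f A' i b by (simp add: left_module_hom_def)
    qed simp
    finally show "(\<Oplus>\<^bsub>M\<^esub>j\<in>{..<m}. A i j \<odot>\<^bsub>M\<^esub> b j) = d i"
      using csol[OF i] \<open>inj_on f (carrier M)\<close> M.finsum_closed[OF cl] d'[OF i]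
      by (simp add: inj_on_eq_iff)
  qed (use b in auto)
qed

end


section \<open>Pp subgroups\<close>

context left_module
begin

text \<open>The defining system is homogeneous and additive in \<open>a\<close> and the witnesses
  together, so witnesses can be added and negated. Multiplication by a scalar need not commute with
  the coefficients, which is why only the additive structure is asserted.\<close>

lemma pp_subgroup_subgroup:
  assumes "pp_subgroup R M H"
  shows "subgroup H (add_monoid M)"
proof -
  from assms obtain n m :: nat and A b
    where A: "A \<in> {..<n} \<rightarrow> {..<m} \<rightarrow> carrier R" and b: "b \<in> {..<n} \<rightarrow> carrier R"
      and H: "H = {a \<in> carrier M. \<exists>c \<in> {..<m} \<rightarrow> carrier M.
          \<forall>i<n. (\<Oplus>\<^bsub>M\<^esub>j\<in>{..<m}. A i j \<odot>\<^bsub>M\<^esub> c j) = b i \<odot>\<^bsub>M\<^esub> a}"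
    unfolding pp_subgroup_def by blast
  have A': "A i j \<in> carrier R" if "i < n" "j < m" for i j
    using Pi_mem[OF Pi_mem[OF A]] that by simp
  have b': "b i \<in> carrier R" if "i < n" for i using b that by auto
  show ?thesis
  proof
    show "H \<subseteq> carrier (add_monoid M)" using H by auto
    have "(\<Oplus>\<^bsub>M\<^esub>j\<in>{..<m}. A i j \<odot>\<^bsub>M\<^esub> \<zero>\<^bsub>M\<^esub>) = b i \<odot>\<^bsub>M\<^esub> \<zero>\<^bsub>M\<^esub>" if "i < n" for i
    proof -
      have "(\<Oplus>\<^bsub>M\<^esub>j\<in>{..<m}. A i j \<odot>\<^bsub>M\<^esub> \<zero>\<^bsub>M\<^esub>) = (\<Oplus>\<^bsub>M\<^esub>j\<in>{..<m}. \<zero>\<^bsub>M\<^esub>)"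
        using A' that by (intro M.finsum_cong') auto
      then show ?thesis using b' that by (simp add: M.finsum_zero)
    qed
    then show "\<one>\<^bsub>add_monoid M\<^esub> \<in> H"
      unfolding H by (auto intro!: bexI[of _ "\<lambda>_. \<zero>\<^bsub>M\<^esub>"])
  next
    fix x y assume "x \<in> H" "y \<in> H"
    then obtain c d where x: "x \<in> carrier M" "y \<in> carrier M"
      and c: "c \<in> {..<m} \<rightarrow> carrier M" "d \<in> {..<m} \<rightarrow> carrier M"
      and sol: "\<And>i. i < n \<Longrightarrow> (\<Oplus>\<^bsub>M\<^esub>j\<in>{..<m}. A i j \<odot>\<^bsub>M\<^esub> c j) = b i \<odot>\<^bsub>M\<^esub> x"
        "\<And>i. i < n \<Longrightarrow> (\<Oplus>\<^bsub>M\<^esub>j\<in>{..<m}. A i j \<odot>\<^bsub>M\<^esub> d j) = b i \<odot>\<^bsub>M\<^esub> y"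
      unfolding H by blast
    have c': "c j \<in> carrier M" "d j \<in> carrier M" if "j < m" for j using c that by auto
    have "(\<Oplus>\<^bsub>M\<^esub>j\<in>{..<m}. A i j \<odot>\<^bsub>M\<^esub> (c j \<oplus>\<^bsub>M\<^esub> d j)) = b i \<odot>\<^bsub>M\<^esub> (x \<oplus>\<^bsub>M\<^esub> y)"
      if i: "i < n" for i
    proof -
      have "(\<Oplus>\<^bsub>M\<^esub>j\<in>{..<m}. A i j \<odot>\<^bsub>M\<^esub> (c j \<oplus>\<^bsub>M\<^esub> d j))
          = (\<Oplus>\<^bsub>M\<^esub>j\<in>{..<m}. A i j \<odot>\<^bsub>M\<^esub> c j \<oplus>\<^bsub>M\<^esub> A i j \<odot>\<^bsub>M\<^esub> d j)"
        using A' c' i by (intro M.finsum_cong') (auto simp: smult_r_distr)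
      also have "\<dots> = b i \<odot>\<^bsub>M\<^esub> x \<oplus>\<^bsub>M\<^esub> b i \<odot>\<^bsub>M\<^esub> y"
        using A' c' i sol by (subst M.finsum_addf) auto
      finally show ?thesis using b' x i by (simp add: smult_r_distr)
    qed
    then show "x \<otimes>\<^bsub>add_monoid M\<^esub> y \<in> H"
      unfolding H using x c' by (auto intro!: bexI[of _ "\<lambda>j. c j \<oplus>\<^bsub>M\<^esub> d j"])
  next
    fix x assume "x \<in> H"
    then obtain c where x: "x \<in> carrier M" and c: "c \<in> {..<m} \<rightarrow> carrier M"
      and sol: "\<And>i. i < n \<Longrightarrow> (\<Oplus>\<^bsub>M\<^esub>j\<in>{..<m}. A i j \<odot>\<^bsub>M\<^esub> c j) = b i \<odot>\<^bsub>M\<^esub> x"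
      unfolding H by blast
    have c': "c j \<in> carrier M" if "j < m" for j using c that by auto
    \<comment> \<open>Negation is an endomorphism of the module, so the rule for homomorphisms
      carries it through the finite sums.\<close>
    have neg: "(\<lambda>x. \<ominus>\<^bsub>M\<^esub> x) \<in> left_module_hom R M M"
      by (auto simp: left_module_hom_def M.minus_add smult_minus)
    have "(\<Oplus>\<^bsub>M\<^esub>j\<in>{..<m}. A i j \<odot>\<^bsub>M\<^esub> (\<ominus>\<^bsub>M\<^esub> c j)) = b i \<odot>\<^bsub>M\<^esub> (\<ominus>\<^bsub>M\<^esub> x)" if i: "i < n" for i
    proof -
      have cl: "(\<lambda>j. A i j \<odot>\<^bsub>M\<^esub> c j) \<in> {..<m} \<rightarrow> carrier M" using A' c' i by auto
      have "(\<Oplus>\<^bsub>M\<^esub>j\<in>{..<m}. A i j \<odot>\<^bsub>M\<^esub> (\<ominus>\<^bsub>M\<^esub> c j)) = (\<Oplus>\<^bsub>M\<^esub>j\<in>{..<m}. \<ominus>\<^bsub>M\<^esub> (A i j \<odot>\<^bsub>M\<^esub> c j))"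
        using A' c' i by (intro M.finsum_cong') (auto simp: smult_minus)
      also have "\<dots> = \<ominus>\<^bsub>M\<^esub> (b i \<odot>\<^bsub>M\<^esub> x)"
        using left_module_hom_finsum[OF left_module_axioms left_module_axioms neg _ cl] sol i by simp
      finally show ?thesis using b' x i by (simp add: smult_minus)
    qed
    then show "inv\<^bsub>add_monoid M\<^esub> x \<in> H"
      unfolding H a_inv_def[symmetric] using x c' by (auto intro!: bexI[of _ "\<lambda>j. \<ominus>\<^bsub>M\<^esub> c j"])
  qed
qed

text \<open>One equation and no witnesses: the left side is the empty sum, and the column
  \<open>b\<close> consists of \<open>r\<close>.\<close>

lemma pp_subgroup_annihilator:
  assumes "r \<in> carrier R"
  shows "pp_subgroup R M {x \<in> carrier M. r \<odot>\<^bsub>M\<^esub> x = \<zero>\<^bsub>M\<^esub>}"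
  unfolding pp_subgroup_def
  by (rule exI[of _ 1], rule exI[of _ 0], rule exI[of _ "\<lambda>_ _. \<zero>"], rule exI[of _ "\<lambda>_. r"])
    (use assms in auto)

text \<open>One equation in one witness: the matrix consists of \<open>r\<close> and the column of
  \<open>\<one>\<close>, so a witness is a preimage under multiplication by
  \<open>r\<close>.\<close>

lemma pp_subgroup_smult_image:
  assumes "r \<in> carrier R"
  shows "pp_subgroup R M ((\<odot>\<^bsub>M\<^esub>) r ` carrier M)"
  unfolding pp_subgroup_def
proof (intro exI conjI)
  show "(\<odot>\<^bsub>M\<^esub>) r ` carrier M = {a \<in> carrier M. \<exists>c \<in> {..<1::nat} \<rightarrow> carrier M.
          \<forall>i<1::nat. (\<Oplus>\<^bsub>M\<^esub>j\<in>{..<1}. r \<odot>\<^bsub>M\<^esub> c j) = \<one> \<odot>\<^bsub>M\<^esub> a}" (is "?L = ?R")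
  proof (intro equalityI subsetI)
    fix a assume "a \<in> ?L"
    then obtain x where "x \<in> carrier M" "a = r \<odot>\<^bsub>M\<^esub> x" by blast
    then show "a \<in> ?R"
      using assms by (auto simp: lessThan_Suc intro!: bexI[of _ "\<lambda>_. x"])
  qed (use assms in \<open>auto simp: lessThan_Suc Pi_iff\<close>)
qed (use assms in auto)

section \<open>Block systems and sums of pp subgroups\<close>

lemma finsum_lessThan_add:
  fixes k l :: nat
  assumes "h \<in> {..<k + l} \<rightarrow> carrier M"
  shows "(\<Oplus>\<^bsub>M\<^esub>j\<in>{..<k + l}. h j) = (\<Oplus>\<^bsub>M\<^esub>j\<in>{..<k}. h j) \<oplus>\<^bsub>M\<^esub> (\<Oplus>\<^bsub>M\<^esub>j\<in>{..<l}. h (k + j))"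
  using assms
proof (induction l)
  case 0
  then show ?case by (simp add: M.finsum_closed)
next
  case (Suc l)
  then have h: "h j \<in> carrier M" if "j \<le> k + l" for j using that by (auto simp: Pi_iff)
  then have "h \<in> {..<k} \<rightarrow> carrier M" "(\<lambda>j. h (k + j)) \<in> {..<l} \<rightarrow> carrier M" by auto
  then have "finsum M h {..<k} \<in> carrier M" "(\<Oplus>\<^bsub>M\<^esub>j\<in>{..<l}. h (k + j)) \<in> carrier M"
    by (auto intro: M.finsum_closed)
  then show ?case
    using Suc.IH h by (simp add: lessThan_Suc M.finsum_insert Pi_iff M.a_ac)
qed

text \<open>Evaluates a row of the combined system for a sum of pp subgroups: two blocks of
  witnesses of lengths \<open>k\<close> and \<open>l\<close>, then a single shared unknown at index
  \<open>k + l\<close>.\<close>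

lemma finsum_block_row:
  fixes k l :: nat
  assumes "u \<in> {..<k} \<rightarrow> carrier R" "v \<in> {..<l} \<rightarrow> carrier R" "w \<in> carrier R"
    and "c \<in> {..<Suc (k + l)} \<rightarrow> carrier M"
  shows "(\<Oplus>\<^bsub>M\<^esub>j\<in>{..<Suc (k + l)}.
      (if j < k then u j else if j < k + l then v (j - k) else w) \<odot>\<^bsub>M\<^esub> c j)
    = w \<odot>\<^bsub>M\<^esub> c (k + l) \<oplus>\<^bsub>M\<^esub>
      ((\<Oplus>\<^bsub>M\<^esub>j\<in>{..<k}. u j \<odot>\<^bsub>M\<^esub> c j) \<oplus>\<^bsub>M\<^esub> (\<Oplus>\<^bsub>M\<^esub>j\<in>{..<l}. v j \<odot>\<^bsub>M\<^esub> c (k + j)))"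
proof -
  let ?h = "\<lambda>j. (if j < k then u j else if j < k + l then v (j - k) else w) \<odot>\<^bsub>M\<^esub> c j"
  have uv: "\<And>j. j < k \<Longrightarrow> u j \<in> carrier R" "\<And>j. j < l \<Longrightarrow> v j \<in> carrier R"
    "\<And>j. j \<le> k + l \<Longrightarrow> c j \<in> carrier M"
    using assms by (auto simp: Pi_iff)
  have h: "?h \<in> {..<k + l} \<rightarrow> carrier M" using uv by auto
  have "(\<Oplus>\<^bsub>M\<^esub>j\<in>{..<Suc (k + l)}. ?h j) = w \<odot>\<^bsub>M\<^esub> c (k + l) \<oplus>\<^bsub>M\<^esub> (\<Oplus>\<^bsub>M\<^esub>j\<in>{..<k + l}. ?h j)"
    unfolding lessThan_Suc using h uv assms(3) by (subst M.finsum_insert) auto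
  also have "(\<Oplus>\<^bsub>M\<^esub>j\<in>{..<k + l}. ?h j) = (\<Oplus>\<^bsub>M\<^esub>j\<in>{..<k}. ?h j) \<oplus>\<^bsub>M\<^esub> (\<Oplus>\<^bsub>M\<^esub>j\<in>{..<l}. ?h (k + j))"
    using h by (rule finsum_lessThan_add)
  also have "(\<Oplus>\<^bsub>M\<^esub>j\<in>{..<k}. ?h j) = (\<Oplus>\<^bsub>M\<^esub>j\<in>{..<k}. u j \<odot>\<^bsub>M\<^esub> c j)"
    using uv by (intro M.finsum_cong') auto
  also have "(\<Oplus>\<^bsub>M\<^esub>j\<in>{..<l}. ?h (k + j)) = (\<Oplus>\<^bsub>M\<^esub>j\<in>{..<l}. v j \<odot>\<^bsub>M\<^esub> c (k + j))"
    using uv by (intro M.finsum_cong') auto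
  finally show ?thesis .
qed

lemma finsum_zero_smult:
  assumes "c \<in> I \<rightarrow> carrier M"
  shows "(\<Oplus>\<^bsub>M\<^esub>i\<in>I. \<zero> \<odot>\<^bsub>M\<^esub> c i) = \<zero>\<^bsub>M\<^esub>"
proof -
  have "(\<Oplus>\<^bsub>M\<^esub>i\<in>I. \<zero> \<odot>\<^bsub>M\<^esub> c i) = (\<Oplus>\<^bsub>M\<^esub>i\<in>I. \<zero>\<^bsub>M\<^esub>)"
    using assms by (intro M.finsum_cong') (auto simp: Pi_iff)
  then show ?thesis by (simp add: M.finsum_zero)
qed

text \<open>\<open>a \<in> H + K\<close> iff some \<open>z \<in> K\<close> has \<open>a - z \<in> H\<close>; the unknown \<open>z\<close> is the last variable of the
  combined system, after the witnesses for \<open>H\<close> and those for \<open>K\<close>.\<close>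

lemma pp_subgroup_set_add:
  assumes "pp_subgroup R M H" "pp_subgroup R M K"
  shows "pp_subgroup R M (H <+>\<^bsub>M\<^esub> K)"
proof -
  from assms(1) obtain n m :: nat and A b
    where A: "A \<in> {..<n} \<rightarrow> {..<m} \<rightarrow> carrier R" and b: "b \<in> {..<n} \<rightarrow> carrier R"
      and H: "H = {a \<in> carrier M. \<exists>c \<in> {..<m} \<rightarrow> carrier M.
          \<forall>i<n. (\<Oplus>\<^bsub>M\<^esub>j\<in>{..<m}. A i j \<odot>\<^bsub>M\<^esub> c j) = b i \<odot>\<^bsub>M\<^esub> a}"
    unfolding pp_subgroup_def by blast
  from assms(2) obtain n' m' :: nat and A' b'
    where A': "A' \<in> {..<n'} \<rightarrow> {..<m'} \<rightarrow> carrier R" and b': "b' \<in> {..<n'} \<rightarrow> carrier R"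
      and K: "K = {a \<in> carrier M. \<exists>c \<in> {..<m'} \<rightarrow> carrier M.
          \<forall>i<n'. (\<Oplus>\<^bsub>M\<^esub>j\<in>{..<m'}. A' i j \<odot>\<^bsub>M\<^esub> c j) = b' i \<odot>\<^bsub>M\<^esub> a}"
    unfolding pp_subgroup_def by blast
  have Ai: "A i \<in> {..<m} \<rightarrow> carrier R" "b i \<in> carrier R" if "i < n" for i
    using A b that by auto
  have Ai': "A' i \<in> {..<m'} \<rightarrow> carrier R" "b' i \<in> carrier R" if "i < n'" for i
    using A' b' that by auto
  \<comment> \<open>With \<open>z\<close> the last unknown, the upper rows say
    \<open>A c + b z = b a\<close> and the lower rows \<open>A' c' - b' z = 0\<close>. The first is
    membership of \<open>a - z\<close> in \<open>H\<close>, the second that of \<open>z\<close> in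
    \<open>K\<close>.\<close>
  define B where "B i j =
    (if i < n then if j < m then A i j else if j < m + m' then \<zero> else b i
     else if j < m then \<zero> else if j < m + m' then A' (i - n) (j - m) else \<ominus> b' (i - n))" for i j
  define e where "e i = (if i < n then b i else \<zero>)" for i
  define sys where "sys c a \<longleftrightarrow>
    (\<forall>i<n + n'. (\<Oplus>\<^bsub>M\<^esub>j\<in>{..<Suc (m + m')}. B i j \<odot>\<^bsub>M\<^esub> c j) = e i \<odot>\<^bsub>M\<^esub> a)" for c a
  have sys: "sys c a \<longleftrightarrow>
      (\<forall>i<n. (\<Oplus>\<^bsub>M\<^esub>j\<in>{..<m}. A i j \<odot>\<^bsub>M\<^esub> c j) = b i \<odot>\<^bsub>M\<^esub> (a \<ominus>\<^bsub>M\<^esub> c (m + m'))) \<and>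
      (\<forall>i<n'. (\<Oplus>\<^bsub>M\<^esub>j\<in>{..<m'}. A' i j \<odot>\<^bsub>M\<^esub> c (m + j)) = b' i \<odot>\<^bsub>M\<^esub> c (m + m'))"
    if c: "c \<in> {..<Suc (m + m')} \<rightarrow> carrier M" and a: "a \<in> carrier M" for c a
  proof -
    have c': "c j \<in> carrier M" if "j \<le> m + m'" for j using c that by (auto simp: Pi_iff)
    have upper: "(\<Oplus>\<^bsub>M\<^esub>j\<in>{..<Suc (m + m')}. B i j \<odot>\<^bsub>M\<^esub> c j) = e i \<odot>\<^bsub>M\<^esub> a \<longleftrightarrow>
      (\<Oplus>\<^bsub>M\<^esub>j\<in>{..<m}. A i j \<odot>\<^bsub>M\<^esub> c j) = b i \<odot>\<^bsub>M\<^esub> (a \<ominus>\<^bsub>M\<^esub> c (m + m'))" if i: "i < n" for i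
    proof -
      let ?s = "\<Oplus>\<^bsub>M\<^esub>j\<in>{..<m}. A i j \<odot>\<^bsub>M\<^esub> c j" and ?z = "c (m + m')"
      have s: "?s \<in> carrier M" using Ai[OF i] c' by (intro M.finsum_closed) auto
      have "(\<Oplus>\<^bsub>M\<^esub>j\<in>{..<Suc (m + m')}. B i j \<odot>\<^bsub>M\<^esub> c j) =
          b i \<odot>\<^bsub>M\<^esub> ?z \<oplus>\<^bsub>M\<^esub> (?s \<oplus>\<^bsub>M\<^esub> (\<Oplus>\<^bsub>M\<^esub>j\<in>{..<m'}. \<zero> \<odot>\<^bsub>M\<^esub> c (m + j)))"
        using finsum_block_row[OF Ai(1)[OF i] _ Ai(2)[OF i] c, of "\<lambda>_. \<zero>"] i
        by (simp add: B_def)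
      also have "\<dots> = b i \<odot>\<^bsub>M\<^esub> ?z \<oplus>\<^bsub>M\<^esub> ?s"
        using s c' by (subst finsum_zero_smult) auto
      finally have row: "(\<Oplus>\<^bsub>M\<^esub>j\<in>{..<Suc (m + m')}. B i j \<odot>\<^bsub>M\<^esub> c j) = b i \<odot>\<^bsub>M\<^esub> ?z \<oplus>\<^bsub>M\<^esub> ?s" .
      \<comment> \<open>Splitting \<open>a\<close> as \<open>z + (a - z)\<close> makes
        \<open>b i\<close> times \<open>z\<close> a common summand of both sides, which then
        cancels.\<close>
      have "b i \<odot>\<^bsub>M\<^esub> a = b i \<odot>\<^bsub>M\<^esub> ?z \<oplus>\<^bsub>M\<^esub> b i \<odot>\<^bsub>M\<^esub> (a \<ominus>\<^bsub>M\<^esub> ?z)"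
        using Ai(2)[OF i] a c'[of "m + m'"]
        by (simp add: a_minus_def smult_r_distr smult_minus M.a_ac M.r_neg M.r_neg1 M.r_neg2)
      then show ?thesis using row s i Ai(2)[OF i] a c'[of "m + m'"] by (simp add: e_def)
    qed
    have lower: "(\<Oplus>\<^bsub>M\<^esub>j\<in>{..<Suc (m + m')}. B (n + i) j \<odot>\<^bsub>M\<^esub> c j) = e (n + i) \<odot>\<^bsub>M\<^esub> a \<longleftrightarrow>
      (\<Oplus>\<^bsub>M\<^esub>j\<in>{..<m'}. A' i j \<odot>\<^bsub>M\<^esub> c (m + j)) = b' i \<odot>\<^bsub>M\<^esub> c (m + m')" if i: "i < n'" for i
    proof -
      let ?s = "\<Oplus>\<^bsub>M\<^esub>j\<in>{..<m'}. A' i j \<odot>\<^bsub>M\<^esub> c (m + j)" and ?z = "c (m + m')"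
      have s: "?s \<in> carrier M" using Ai'[OF i] c' by (intro M.finsum_closed) auto
      have "B (n + i) = (\<lambda>j. if j < m then \<zero> else if j < m + m' then A' i (j - m) else \<ominus> b' i)"
        by (auto simp: B_def)
      then have "(\<Oplus>\<^bsub>M\<^esub>j\<in>{..<Suc (m + m')}. B (n + i) j \<odot>\<^bsub>M\<^esub> c j) =
          (\<ominus> b' i) \<odot>\<^bsub>M\<^esub> ?z \<oplus>\<^bsub>M\<^esub> ((\<Oplus>\<^bsub>M\<^esub>j\<in>{..<m}. \<zero> \<odot>\<^bsub>M\<^esub> c j) \<oplus>\<^bsub>M\<^esub> ?s)"
        using finsum_block_row[OF _ Ai'(1)[OF i] R.a_inv_closed[OF Ai'(2)[OF i]] c, of "\<lambda>_. \<zero>"]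
        by simp
      also have "\<dots> = (\<ominus> b' i) \<odot>\<^bsub>M\<^esub> ?z \<oplus>\<^bsub>M\<^esub> ?s"
        using s c' by (subst finsum_zero_smult) auto
      finally have row: "(\<Oplus>\<^bsub>M\<^esub>j\<in>{..<Suc (m + m')}. B (n + i) j \<odot>\<^bsub>M\<^esub> c j)
        = (\<ominus> b' i) \<odot>\<^bsub>M\<^esub> ?z \<oplus>\<^bsub>M\<^esub> ?s" .
      \<comment> \<open>The right side of a lower row is zero; written as this sum it shares its
        first summand with the left side, and cancellation leaves the equation for
        \<open>K\<close>.\<close>
      have "(\<ominus> b' i) \<odot>\<^bsub>M\<^esub> ?z \<oplus>\<^bsub>M\<^esub> b' i \<odot>\<^bsub>M\<^esub> ?z = \<zero>\<^bsub>M\<^esub>"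
        using Ai'(2)[OF i] c'[of "m + m'"] by (simp add: R.l_neg flip: smult_l_distr)
      then have rhs: "e (n + i) \<odot>\<^bsub>M\<^esub> a = (\<ominus> b' i) \<odot>\<^bsub>M\<^esub> ?z \<oplus>\<^bsub>M\<^esub> b' i \<odot>\<^bsub>M\<^esub> ?z"
        using a by (simp add: e_def)
      have "(\<ominus> b' i) \<odot>\<^bsub>M\<^esub> ?z \<in> carrier M" "b' i \<odot>\<^bsub>M\<^esub> ?z \<in> carrier M"
        using Ai'(2)[OF i] c'[of "m + m'"] by simp_all
      from M.add.l_cancel[OF _ s this(2,1)] show ?thesis unfolding row rhs by (intro iffI) simp_all
    qed
    have "sys c a \<longleftrightarrow> (\<forall>i<n. (\<Oplus>\<^bsub>M\<^esub>j\<in>{..<Suc (m + m')}. B i j \<odot>\<^bsub>M\<^esub> c j) = e i \<odot>\<^bsub>M\<^esub> a) \<and>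
        (\<forall>i<n'. (\<Oplus>\<^bsub>M\<^esub>j\<in>{..<Suc (m + m')}. B (n + i) j \<odot>\<^bsub>M\<^esub> c j) = e (n + i) \<odot>\<^bsub>M\<^esub> a)"
      (is "_ \<longleftrightarrow> ?U \<and> ?V")
    proof
      assume "sys c a"
      then show "?U \<and> ?V" unfolding sys_def by (intro conjI allI impI) simp_all
    next
      assume UV: "?U \<and> ?V"
      show "sys c a" unfolding sys_def
      proof (intro allI impI)
        fix i assume i: "i < n + n'"
        show "(\<Oplus>\<^bsub>M\<^esub>j\<in>{..<Suc (m + m')}. B i j \<odot>\<^bsub>M\<^esub> c j) = e i \<odot>\<^bsub>M\<^esub> a"
        proof (cases "i < n")
          case True
          then show ?thesis using UV by blast
        next
          case False
          then have "i = n + (i - n)" "i - n < n'" using i by simp_all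
          then show ?thesis using UV by metis
        qed
      qed
    qed
    then show ?thesis using upper lower by simp
  qed
  have "H <+>\<^bsub>M\<^esub> K = {a \<in> carrier M. \<exists>c \<in> {..<Suc (m + m')} \<rightarrow> carrier M. sys c a}"
  proof (intro equalityI subsetI)
    fix a assume "a \<in> H <+>\<^bsub>M\<^esub> K"
    then obtain x z where xz: "x \<in> H" "z \<in> K" "a = x \<oplus>\<^bsub>M\<^esub> z"
      by (auto simp: set_add_def set_mult_def)
    obtain c where c1: "x \<in> carrier M" "c \<in> {..<m} \<rightarrow> carrier M"
        "\<And>i. i < n \<Longrightarrow> (\<Oplus>\<^bsub>M\<^esub>j\<in>{..<m}. A i j \<odot>\<^bsub>M\<^esub> c j) = b i \<odot>\<^bsub>M\<^esub> x"
      using xz(1) unfolding H by blast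
    obtain c' where c2: "z \<in> carrier M" "c' \<in> {..<m'} \<rightarrow> carrier M"
        "\<And>i. i < n' \<Longrightarrow> (\<Oplus>\<^bsub>M\<^esub>j\<in>{..<m'}. A' i j \<odot>\<^bsub>M\<^esub> c' j) = b' i \<odot>\<^bsub>M\<^esub> z"
      using xz(2) unfolding K by blast
    note c = c1 c2
    \<comment> \<open>Concatenates the witnesses for \<open>x\<close> and for \<open>z\<close> and
      puts \<open>z\<close> itself at index \<open>m + m'\<close>.\<close>
    let ?c = "\<lambda>j. if j < m then c j else if j < m + m' then c' (j - m) else z"
    have cl: "?c \<in> {..<Suc (m + m')} \<rightarrow> carrier M" using c by (auto simp: Pi_iff)
    have "(\<Oplus>\<^bsub>M\<^esub>j\<in>{..<m}. A i j \<odot>\<^bsub>M\<^esub> ?c j) = (\<Oplus>\<^bsub>M\<^esub>j\<in>{..<m}. A i j \<odot>\<^bsub>M\<^esub> c j)" if "i < n" for i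
      using Ai[OF that] c by (intro M.finsum_cong') (auto simp: Pi_iff)
    moreover have "(\<Oplus>\<^bsub>M\<^esub>j\<in>{..<m'}. A' i j \<odot>\<^bsub>M\<^esub> ?c (m + j)) = (\<Oplus>\<^bsub>M\<^esub>j\<in>{..<m'}. A' i j \<odot>\<^bsub>M\<^esub> c' j)"
      if "i < n'" for i
      using Ai'[OF that] c by (intro M.finsum_cong') (auto simp: Pi_iff)
    moreover have "a \<ominus>\<^bsub>M\<^esub> z = x" using c xz by (simp add: a_minus_def M.a_assoc M.r_neg)
    moreover have "a \<in> carrier M" using c xz by simp
    ultimately have "sys ?c a" using sys[OF cl] c by simp
    then show "a \<in> {a \<in> carrier M. \<exists>c \<in> {..<Suc (m + m')} \<rightarrow> carrier M. sys c a}"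
      using cl \<open>a \<in> carrier M\<close> by blast
  next
    fix a assume "a \<in> {a \<in> carrier M. \<exists>c \<in> {..<Suc (m + m')} \<rightarrow> carrier M. sys c a}"
    then obtain c where a: "a \<in> carrier M" and c: "c \<in> {..<Suc (m + m')} \<rightarrow> carrier M"
      and "sys c a" by blast
    let ?z = "c (m + m')"
    have c': "c j \<in> carrier M" if "j \<le> m + m'" for j using c that by (auto simp: Pi_iff)
    \<comment> \<open>Conversely, the first block of \<open>c\<close> witnesses that
      \<open>a - z\<close> lies in \<open>H\<close>, and the second, shifted by \<open>m\<close>,
      that \<open>z\<close> lies in \<open>K\<close>.\<close>
    have "c \<in> {..<m} \<rightarrow> carrier M" "(\<lambda>j. c (m + j)) \<in> {..<m'} \<rightarrow> carrier M" using c' by auto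
    with sys[OF c a] \<open>sys c a\<close> a c'[of "m + m'"] have "a \<ominus>\<^bsub>M\<^esub> ?z \<in> H" "?z \<in> K"
      unfolding H K by (auto intro: bexI[of _ c] bexI[of _ "\<lambda>j. c (m + j)"])
    moreover have "a = (a \<ominus>\<^bsub>M\<^esub> ?z) \<oplus>\<^bsub>M\<^esub> ?z"
      using a c'[of "m + m'"] by (simp add: a_minus_def M.a_assoc M.l_neg)
    ultimately show "a \<in> H <+>\<^bsub>M\<^esub> K" by (auto simp: set_add_def set_mult_def)
  qed
  moreover have "B \<in> {..<n + n'} \<rightarrow> {..<Suc (m + m')} \<rightarrow> carrier R"
  proof (intro Pi_I)
    fix i j assume ij: "i \<in> {..<n + n'}" "j \<in> {..<Suc (m + m')}"
    show "B i j \<in> carrier R"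
    proof (cases "i < n")
      case True
      then show ?thesis using Ai[OF True] by (auto simp: B_def Pi_iff)
    next
      case False
      then have "i - n < n'" using ij by auto
      then show ?thesis using Ai'[of "i - n"] ij False by (auto simp: B_def Pi_iff)
    qed
  qed
  moreover have "e \<in> {..<n + n'} \<rightarrow> carrier R" using Ai by (auto simp: e_def)
  ultimately show ?thesis unfolding pp_subgroup_def sys_def
    by (intro exI[of _ "n + n'"] exI[of _ "Suc (m + m')"] exI[of _ B] exI[of _ e] conjI)
qed

section \<open>Nonzero scalars annihilating proper pp subgroups\<close>

text \<open>For \<open>a\<close> outside \<open>H\<close> the system \<open>A c = b a\<close> has no
  solution, so it is inconsistent: some row \<open>y\<close> has \<open>y A = 0\<close> but
  \<open>y b a \<noteq> 0\<close>. The scalar \<open>r = y b\<close> is nonzero because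
  \<open>r a \<noteq> 0\<close>, and it annihilates \<open>H\<close> because
  \<open>b x = A c\<close> gives \<open>r x = y A c = 0\<close>.\<close>

lemma proper_pp_subgroup_annihilated:
  assumes "absolutely_pure R M" and "pp_subgroup R M H" "H \<noteq> carrier M"
  shows "\<exists>r\<in>carrier R. r \<noteq> \<zero> \<and> (\<forall>x\<in>H. r \<odot>\<^bsub>M\<^esub> x = \<zero>\<^bsub>M\<^esub>)"
proof -
  from assms(2) obtain n m :: nat and A b
    where A: "A \<in> {..<n} \<rightarrow> {..<m} \<rightarrow> carrier R" and b: "b \<in> {..<n} \<rightarrow> carrier R"
      and H: "H = {a \<in> carrier M. \<exists>c \<in> {..<m} \<rightarrow> carrier M.
          \<forall>i<n. (\<Oplus>\<^bsub>M\<^esub>j\<in>{..<m}. A i j \<odot>\<^bsub>M\<^esub> c j) = b i \<odot>\<^bsub>M\<^esub> a}"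
    unfolding pp_subgroup_def by blast
  have A': "A i j \<in> carrier R" if "i < n" "j < m" for i j
    using Pi_mem[OF Pi_mem[OF A]] that by simp
  have b': "b i \<in> carrier R" if "i < n" for i using b that by auto
  from assms(3) obtain a where a: "a \<in> carrier M" "a \<notin> H" using H by blast
  have "(\<lambda>i. b i \<odot>\<^bsub>M\<^esub> a) \<in> {..<n} \<rightarrow> carrier M" using a b' by auto
  from absolutely_pure_solvable[OF assms(1) A this] a
  obtain y where y: "y \<in> {..<n} \<rightarrow> carrier R"
    and yA: "\<And>j. j < m \<Longrightarrow> (\<Oplus>i\<in>{..<n}. y i \<otimes> A i j) = \<zero>"
    and ya: "(\<Oplus>\<^bsub>M\<^esub>i\<in>{..<n}. y i \<odot>\<^bsub>M\<^esub> (b i \<odot>\<^bsub>M\<^esub> a)) \<noteq> \<zero>\<^bsub>M\<^esub>"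
    unfolding H by blast
  have y': "y i \<in> carrier R" if "i < n" for i using y that by auto
  define r where "r = (\<Oplus>i\<in>{..<n}. y i \<otimes> b i)"
  have r: "r \<in> carrier R" unfolding r_def using y' b' by (intro R.finsum_closed) auto
  have rx: "r \<odot>\<^bsub>M\<^esub> x = (\<Oplus>\<^bsub>M\<^esub>i\<in>{..<n}. y i \<odot>\<^bsub>M\<^esub> (b i \<odot>\<^bsub>M\<^esub> x))" if "x \<in> carrier M" for x
    unfolding r_def using y' b' that
    by (subst finsum_scalars_smult) (auto simp: smult_assoc1 intro!: M.finsum_cong')
  have "r \<odot>\<^bsub>M\<^esub> x = \<zero>\<^bsub>M\<^esub>" if "x \<in> H" for x
  proof -
    from that obtain c where x: "x \<in> carrier M" and c: "c \<in> {..<m} \<rightarrow> carrier M"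
      and sol: "\<And>i. i < n \<Longrightarrow> (\<Oplus>\<^bsub>M\<^esub>j\<in>{..<m}. A i j \<odot>\<^bsub>M\<^esub> c j) = b i \<odot>\<^bsub>M\<^esub> x"
      unfolding H by blast
    have c': "c j \<in> carrier M" if "j < m" for j using c that by auto
    have "r \<odot>\<^bsub>M\<^esub> x = (\<Oplus>\<^bsub>M\<^esub>i\<in>{..<n}. y i \<odot>\<^bsub>M\<^esub> (\<Oplus>\<^bsub>M\<^esub>j\<in>{..<m}. A i j \<odot>\<^bsub>M\<^esub> c j))"
      unfolding rx[OF x] using sol y' b' x by (intro M.finsum_cong') auto
    also have "\<dots> = (\<Oplus>\<^bsub>M\<^esub>i\<in>{..<n}. \<Oplus>\<^bsub>M\<^esub>j\<in>{..<m}. (y i \<otimes> A i j) \<odot>\<^bsub>M\<^esub> c j)"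
    proof (rule M.finsum_cong')
      show "(\<lambda>i. \<Oplus>\<^bsub>M\<^esub>j\<in>{..<m}. (y i \<otimes> A i j) \<odot>\<^bsub>M\<^esub> c j) \<in> {..<n} \<rightarrow> carrier M"
        using y' A' c' by (intro Pi_I M.finsum_closed) auto
      fix i assume "i \<in> {..<n}"
      then show "y i \<odot>\<^bsub>M\<^esub> (\<Oplus>\<^bsub>M\<^esub>j\<in>{..<m}. A i j \<odot>\<^bsub>M\<^esub> c j) = (\<Oplus>\<^bsub>M\<^esub>j\<in>{..<m}. (y i \<otimes> A i j) \<odot>\<^bsub>M\<^esub> c j)"
        using y' A' c' by (subst finsum_smult) (auto simp: smult_assoc1 intro!: M.finsum_cong')
    qed simp
    \<comment> \<open>Grouped by columns, each inner sum is entry \<open>j\<close> of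
      \<open>y A\<close> applied to \<open>c j\<close>, and that entry is zero.\<close>
    also have "\<dots> = (\<Oplus>\<^bsub>M\<^esub>j\<in>{..<m}. \<Oplus>\<^bsub>M\<^esub>i\<in>{..<n}. (y i \<otimes> A i j) \<odot>\<^bsub>M\<^esub> c j)"
      using y' A' c' by (intro finsum_swap) auto
    also have "\<dots> = (\<Oplus>\<^bsub>M\<^esub>j\<in>{..<m}. \<zero>\<^bsub>M\<^esub>)"
    proof (rule M.finsum_cong')
      fix j assume j: "j \<in> {..<m}"
      have "(\<Oplus>\<^bsub>M\<^esub>i\<in>{..<n}. (y i \<otimes> A i j) \<odot>\<^bsub>M\<^esub> c j) = (\<Oplus>i\<in>{..<n}. y i \<otimes> A i j) \<odot>\<^bsub>M\<^esub> c j"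
        using j y' A' c' by (intro finsum_scalars_smult[symmetric]) auto
      then show "(\<Oplus>\<^bsub>M\<^esub>i\<in>{..<n}. (y i \<otimes> A i j) \<odot>\<^bsub>M\<^esub> c j) = \<zero>\<^bsub>M\<^esub>" using yA c' j by simp
    qed auto
    finally show ?thesis by (simp add: M.finsum_zero)
  qed
  moreover have "r \<noteq> \<zero>" using ya rx[OF a(1)] a(1) by auto
  ultimately show ?thesis using r by blast
qed

section \<open>Maximal pp subgroups from the absence of ascending chains\<close>

text \<open>If no pp subgroup above \<open>H\<close> were maximal, every proper one above
  \<open>H\<close> would lie strictly inside another proper one, and dependent choice would build an
  infinite ascending chain starting from \<open>H\<close>.\<close>

lemma maximal_pp_subgroup_exists:
  assumes H: "pp_subgroup R M H" "H \<noteq> carrier M"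
    and no_chain: "\<nexists>C :: nat \<Rightarrow> 'm set. \<forall>i. pp_subgroup R M (C i) \<and> H \<subseteq> C i \<and> C i \<subset> C (Suc i)"
  shows "\<exists>P. maximal_pp_subgroup R M P \<and> H \<subseteq> P"
proof (rule ccontr)
  assume "\<nexists>P. maximal_pp_subgroup R M P \<and> H \<subseteq> P"
  then have not_max: "\<not> maximal_pp_subgroup R M P" if "H \<subseteq> P" for P using that by blast
  define proper where "proper Q \<longleftrightarrow> pp_subgroup R M Q \<and> Q \<noteq> carrier M \<and> H \<subseteq> Q" for Q
  have step: "\<exists>Q. proper Q \<and> P \<subset> Q" if "proper P" for P
  proof -
    have P: "pp_subgroup R M P" "P \<noteq> carrier M" "H \<subseteq> P" using that by (simp_all add: proper_def)
    then obtain Q where "pp_subgroup R M Q" "Q \<noteq> carrier M" "P \<subseteq> Q" "Q \<noteq> P"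
      using not_max[OF P(3)] unfolding maximal_pp_subgroup_def by blast
    then show ?thesis using P(3) by (intro exI[of _ Q]) (auto simp: proper_def)
  qed
  have "\<exists>C :: nat \<Rightarrow> 'm set. \<forall>i. proper (C i) \<and> C i \<subset> C (Suc i)"
  proof (rule dependent_nat_choice)
    show "\<exists>Q. proper Q" using H by (auto simp: proper_def)
  qed (rule step)
  then obtain C :: "nat \<Rightarrow> 'm set" where "\<forall>i. proper (C i) \<and> C i \<subset> C (Suc i)" by (rule exE)
  then have "\<forall>i. pp_subgroup R M (C i) \<and> H \<subseteq> C i \<and> C i \<subset> C (Suc i)"
    by (simp add: proper_def)
  then show False using no_chain by (elim notE) (rule exI)
qed

end

section \<open>A minimal complement to a maximal pp subgroup\<close>

theorem corollary4p23:
  fixes R :: "('r, 'x) ring_scheme" and M :: "('r, 'm, 'y) module_scheme"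
  assumes "reduced_ring R" and "left_module R M"
    and "faithful_module R M" and "absolutely_pure R M"
  shows "(\<forall>H. pp_subgroup R M H \<and> H \<noteq> carrier M \<longrightarrow>
            (\<exists>C :: nat \<Rightarrow> 'm set. \<forall>i. pp_subgroup R M (C i) \<and> H \<subseteq> C i \<and> C i \<subset> C (Suc i)))
       \<or> pp_simple R M
       \<or> (\<exists>K P. minimal_pp_subgroup R M K \<and> maximal_pp_subgroup R M P \<and>
            \<not> K \<subseteq> P \<and> \<not> P \<subseteq> K \<and> K <+>\<^bsub>M\<^esub> P = carrier M)"
proof (rule ccontr)
  interpret left_module R M by fact
  interpret reduced_ring R by fact
  let ?ann = "\<lambda>r. {x \<in> carrier M. r \<odot>\<^bsub>M\<^esub> x = \<zero>\<^bsub>M\<^esub>}"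
  assume not: "\<not> ?thesis"
  then obtain H where "pp_subgroup R M H" "H \<noteq> carrier M"
    "\<nexists>C :: nat \<Rightarrow> 'm set. \<forall>i. pp_subgroup R M (C i) \<and> H \<subseteq> C i \<and> C i \<subset> C (Suc i)"
    unfolding de_Morgan_disj not_all not_imp by (elim conjE exE)
  from maximal_pp_subgroup_exists[OF this] obtain P where P: "maximal_pp_subgroup R M P" by blast
  then have pp_P: "pp_subgroup R M P" "P \<noteq> carrier M"
    and P_max: "\<And>Q. \<lbrakk>pp_subgroup R M Q; Q \<noteq> carrier M; P \<subseteq> Q\<rbrakk> \<Longrightarrow> Q = P"
    by (auto simp: maximal_pp_subgroup_def)
  interpret P: subgroup P "add_monoid M" using pp_P(1) by (rule pp_subgroup_subgroup)
  have zero: "\<zero>\<^bsub>M\<^esub> \<in> Q" if "pp_subgroup R M Q" for Q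
    using subgroup.one_closed[OF pp_subgroup_subgroup[OF that]] by simp
  \<comment> \<open>Every pp subgroup contains zero. So if \<open>P\<close> were zero, it would lie
    below every proper pp subgroup, and maximality would make all of these zero, contrary to the
    failure of pp-simplicity.\<close>
  have P_ne: "P \<noteq> {\<zero>\<^bsub>M\<^esub>}"
    using not P_max zero unfolding pp_simple_def by blast
  obtain r where r: "r \<in> carrier R" "r \<noteq> \<zero>\<^bsub>R\<^esub>" "\<And>x. x \<in> P \<Longrightarrow> r \<odot>\<^bsub>M\<^esub> x = \<zero>\<^bsub>M\<^esub>"
    using proper_pp_subgroup_annihilated[OF assms(4) pp_P] by blast
  \<comment> \<open>Faithfulness makes the annihilator in \<open>M\<close> of a nonzero scalar
    proper, so maximality leaves no room above \<open>P\<close>.\<close>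
  have ann_eq: "?ann s = P" if "s \<in> carrier R" "s \<noteq> \<zero>\<^bsub>R\<^esub>" "P \<subseteq> ?ann s" for s
  proof (rule P_max[OF pp_subgroup_annihilator])
    show "?ann s \<noteq> carrier M" using assms(3) that unfolding faithful_module_def by blast
  qed (use that in auto)
  have P_sub: "P \<subseteq> carrier M" using P.subset by simp
  have ann_r: "?ann r = P" using r P_sub by (intro ann_eq) auto
  \<comment> \<open>Reducedness enters here, with exponent 2.\<close>
  have "r \<otimes>\<^bsub>R\<^esub> r \<noteq> \<zero>\<^bsub>R\<^esub>"
    using nilpotent_zero[of r 2] r by (auto simp: numeral_2_eq_2)
  then have ann_rr: "?ann (r \<otimes>\<^bsub>R\<^esub> r) = P" using r P_sub by (intro ann_eq) (auto simp: smult_assoc1)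
  define K where "K = (\<odot>\<^bsub>M\<^esub>) r ` carrier M"
  have pp_K: "pp_subgroup R M K" unfolding K_def using r by (intro pp_subgroup_smult_image)
  interpret K: subgroup K "add_monoid M" using pp_K by (rule pp_subgroup_subgroup)
  \<comment> \<open>An element \<open>r x\<close> of \<open>P\<close> is killed by \<open>r\<close>,
    so \<open>x\<close> is killed by \<open>r^2\<close>. Both annihilators equal \<open>P\<close>,
    hence \<open>r x = 0\<close> already.\<close>
  have KP: "z = \<zero>\<^bsub>M\<^esub>" if "z \<in> K" "z \<in> P" for z
  proof -
    obtain x where x: "x \<in> carrier M" "z = r \<odot>\<^bsub>M\<^esub> x" using \<open>z \<in> K\<close> by (auto simp: K_def)
    then have "x \<in> ?ann (r \<otimes>\<^bsub>R\<^esub> r)" using r \<open>z \<in> P\<close> by (simp add: smult_assoc1)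
    then show ?thesis using x ann_r ann_rr by blast
  qed
  have K_ne: "K \<noteq> {\<zero>\<^bsub>M\<^esub>}" using r(1,2) assms(3) unfolding faithful_module_def K_def by blast
  \<comment> \<open>\<open>L + P\<close> is a pp subgroup above \<open>P\<close>. If it were proper
    it would equal \<open>P\<close>, so \<open>L\<close> would lie in both \<open>K\<close> and
    \<open>P\<close> and be zero.\<close>
  have sum: "L <+>\<^bsub>M\<^esub> P = carrier M" if L: "pp_subgroup R M L" "L \<noteq> {\<zero>\<^bsub>M\<^esub>}" "L \<subseteq> K" for L
  proof (rule ccontr)
    interpret L: subgroup L "add_monoid M" using L(1) by (rule pp_subgroup_subgroup)
    have sub: "P \<subseteq> L <+>\<^bsub>M\<^esub> P" "L \<subseteq> L <+>\<^bsub>M\<^esub> P"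
      using zero[OF L(1)] zero[OF pp_P(1)] P_sub L.subset
      by (force simp: set_add_def set_mult_def)+
    assume "L <+>\<^bsub>M\<^esub> P \<noteq> carrier M"
    then have "L <+>\<^bsub>M\<^esub> P = P" using P_max[OF pp_subgroup_set_add[OF L(1) pp_P(1)]] sub by blast
    then show False using L zero KP sub by blast
  qed
  \<comment> \<open>The modular law, elementwise: write \<open>k = l + p\<close>; then
    \<open>p = k - l\<close> lies in both \<open>K\<close> and \<open>P\<close>, so
    \<open>p = 0\<close> and \<open>k = l\<close>.\<close>
  have "L = K" if L: "pp_subgroup R M L" "L \<noteq> {\<zero>\<^bsub>M\<^esub>}" "L \<subseteq> K" for L
  proof
    show "K \<subseteq> L"
    proof
      fix k assume k: "k \<in> K"
      then have "k \<in> carrier M" using K.subset by auto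
      then have "k \<in> L <+>\<^bsub>M\<^esub> P" using sum[OF L] by simp
      then obtain l p where lp: "l \<in> L" "p \<in> P" "k = l \<oplus>\<^bsub>M\<^esub> p"
        by (auto simp: set_add_def set_mult_def)
      then have lpM: "l \<in> K" "l \<in> carrier M" "p \<in> carrier M" using L(3) K.subset P_sub by auto
      have "p = \<ominus>\<^bsub>M\<^esub> l \<oplus>\<^bsub>M\<^esub> k" using lp lpM by (simp add: M.r_neg1)
      then have "p \<in> K"
        using K.m_closed[OF K.m_inv_closed[OF lpM(1)] k] by (simp add: a_inv_def)
      then have "p = \<zero>\<^bsub>M\<^esub>" using KP lp by blast
      then show "k \<in> L" using lp lpM by simp
    qed
  qed (rule L(3))
  then have "minimal_pp_subgroup R M K" using pp_K K_ne by (auto simp: minimal_pp_subgroup_def)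
  \<comment> \<open>\<open>K\<close> and \<open>P\<close> are nonzero and meet only in zero, so
    neither contains the other.\<close>
  moreover have "\<not> K \<subseteq> P" using KP K_ne zero[OF pp_K] by blast
  moreover have "\<not> P \<subseteq> K" using KP P_ne zero[OF pp_P(1)] by blast
  moreover have "K <+>\<^bsub>M\<^esub> P = carrier M" using sum[OF pp_K K_ne] by blast
  ultimately show False using not P by blast
qed

end
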